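(* Let $N\ge1$ and $T>0$, and let $f\colon[0,T]\to\mathbb{R}$ be Riemann integrable on $[0,T]$. Let $c\colon[0,T]\to\mathbb{R}^N$ be the exact solution (in the extended sense) of the LegS ODE $c'(t)=-\frac1tAc(t)+\frac1tBf(t)$ with $c(0)=f(0)e_1$. For each $n\ge1$ let $h=T/n$, $t_k=kh$ for $k=0,1,\dots,n$, and let $c^0=f(0)e_1,c^1,\dots,c^n\in\mathbb{R}^N$ be the iterates produced on this mesh by any one of the following methods: forward Euler, backward Euler, bilinear, approximate bilinear, or zero-order hold. Then, for each of these methods, $$\|c^n-c(t_n)\|\to0\qquad\text{as }n\to\infty$$ (where $t_n=nh=T$, and $c^n$ is the last iterate on the mesh with $n$ steps).
   Context: LegS matrices: $A\in\mathbb{R}^{N\times N}$ and $B\in\mathbb{R}^{N}$ are given, with indices $i,j\in\{1,\dots,N\}$, by $A_{ij}=(2i-1)^{1/2}(2j-1)^{1/2}$ if $i>j$, $A_{ii}=i$, $A_{ij}=0$ if $i<j$, and $B_j=(2j-1)^{1/2}$; $e_1$ is the first standard basis vector of $\mathbb{R}^N$. Solution in the extended sense: $c\colon[0,T]\to\mathbb{R}^N$ is continuous on $[0,T]$, absolutely continuous on $[\varepsilon,T]$ for every $\varepsilon\in(0,T)$, satisfies the ODE for almost all $t\in(0,T]$, and has the prescribed value at $t=0$. Discretization methods, on the mesh $t_k=kh$, $h=T/n$, with $f^k=f(kh)$ and $c^0=f(0)e_1$: Forward Euler: $c^1=c^0$, and for $k=1,\dots,n-1$, $c^{k+1}=(I-\frac1kA)c^k+\frac1kBf^k$.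 Backward Euler: for $k=0,\dots,n-1$, $c^{k+1}=(I+\frac1{k+1}A)^{-1}c^k+(I+\frac1{k+1}A)^{-1}\frac1{k+1}Bf^{k+1}$. Bilinear: $c^1=(I+\frac12A)^{-1}c^0+\frac12(I+\frac12A)^{-1}Bf^1$, and for $k=1,\dots,n-1$, $c^{k+1}=(I+\frac1{2(k+1)}A)^{-1}(I-\frac1{2k}A)c^k+(I+\frac1{2(k+1)}A)^{-1}\big(\frac1{2k}f^k+\frac1{2(k+1)}f^{k+1}\big)B$. Approximate bilinear: for $k=0,\dots,n-1$, $c^{k+1}=(I+\frac1{2(k+1)}A)^{-1}(I-\frac1{2(k+1)}A)c^k+(I+\frac1{2(k+1)}A)^{-1}\frac1{k+1}f^{k+1}B$. Zero-order hold: for $k=0,\dots,n-1$, $c^{k+1}=e^{A\log(k/(k+1))}c^k+A^{-1}\big(I-e^{A\log(k/(k+1))}\big)Bf^k$, where $e^{A\log(k/(k+1))}$ is set to be $0$ for $k=0$. *)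

theory Defs
  imports "HOL-Analysis.Analysis"
begin

text \<open>
  \<open>\<real>\<^sup>N\<close> is rendered as \<^typ>\<open>real ^ 'n\<close> with \<open>N = CARD('n)\<close>; the order on \<open>'n\<close> numbers
  the coordinates by \<open>1, \<dots>, N\<close>. The numeral types provide such an index type for every \<open>N \<ge> 1\<close>.
\<close>

definition pos :: "'n::{finite,wellorder} \<Rightarrow> nat" where
  "pos i = card {..i}"

lemma bij_betw_pos: "bij_betw pos (UNIV :: 'n::{finite,wellorder} set) {1..CARD('n)}"
proof -
  have mono: "pos i < pos j" if "i < j" for i j :: 'n
    unfolding pos_def using that by (intro psubset_card_mono) auto
  have inj: "inj (pos :: 'n \<Rightarrow> nat)"
    by (rule injI) (metis mono less_irrefl linorder_neqE)
  have "1 \<le> pos i \<and> pos i \<le> CARD('n)" for i :: 'n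
    unfolding pos_def by (auto simp: Suc_le_eq card_gt_0_iff intro: card_mono)
  then have sub: "pos ` (UNIV :: 'n set) \<subseteq> {1..CARD('n)}"
    by auto
  have "pos ` (UNIV :: 'n set) = {1..CARD('n)}"
    by (rule card_subset_eq) (use sub card_image[OF inj] in auto)
  with inj show ?thesis by (simp add: bij_betw_def)
qed

definition legs_A :: "real ^ 'n::{finite,wellorder} ^ 'n::{finite,wellorder}" where
  "legs_A = (\<chi> i j.
     if pos i > pos j then sqrt (2 * real (pos i) - 1) * sqrt (2 * real (pos j) - 1)
     else if pos i = pos j then real (pos i)
     else 0)"

definition legs_B :: "real ^ 'n::{finite,wellorder}" where
  "legs_B = (\<chi> j. sqrt (2 * real (pos j) - 1))"

definition e1 :: "real ^ 'n::{finite,wellorder}" where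
  "e1 = (\<chi> i. if pos i = 1 then 1 else 0)"

text \<open>
  The product \<open>*\<close> on \<^typ>\<open>real ^ 'n ^ 'n\<close> is componentwise, so the generic \<^const>\<open>exp\<close> is not
  the matrix exponential.
\<close>

definition mat_exp :: "real ^ 'n ^ 'n \<Rightarrow> real ^ 'n ^ 'n" where
  "mat_exp M = (\<Sum>k. (1 / fact k) *\<^sub>R (((**) M ^^ k) (mat 1)))"

text \<open>
  The library's \<open>integrable_on\<close> is Henstock--Kurzweil integrability. The Riemann integral requires
  the Riemann sums to converge uniformly over all tagged divisions of small mesh.
\<close>

definition riemann_integrable_on :: "(real \<Rightarrow> real) \<Rightarrow> real \<Rightarrow> real \<Rightarrow> bool" where
  "riemann_integrable_on f a b \<longleftrightarrow>
     (\<exists>I. \<forall>\<epsilon>>0. \<exists>\<delta>>0. \<forall>p. p tagged_division_of {a..b} \<and> (\<forall>(x, K)\<in>p. measure lborel K < \<delta>) \<longrightarrow>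
        \<bar>(\<Sum>(x, K)\<in>p. measure lborel K * f x) - I\<bar> < \<epsilon>)"

text \<open>
  The divisions of subsets of \<open>{a..b}\<close> are exactly the finite families of non-overlapping closed
  subintervals.
\<close>

definition abs_continuous_on :: "(real \<Rightarrow> 'a::real_normed_vector) \<Rightarrow> real \<Rightarrow> real \<Rightarrow> bool" where
  "abs_continuous_on g a b \<longleftrightarrow>
     (\<forall>\<epsilon>>0. \<exists>\<delta>>0. \<forall>d S. d division_of S \<and> S \<subseteq> {a..b} \<and> (\<Sum>K\<in>d. measure lborel K) < \<delta> \<longrightarrow>
        (\<Sum>K\<in>d. norm (g (Sup K) - g (Inf K))) < \<epsilon>)"

definition legs_solution ::
  "real \<Rightarrow> (real \<Rightarrow> real) \<Rightarrow> (real \<Rightarrow> real ^ 'n::{finite,wellorder}) \<Rightarrow> bool" where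
  "legs_solution T f c \<longleftrightarrow>
     continuous_on {0..T} c \<and>
     (\<forall>\<epsilon>. 0 < \<epsilon> \<and> \<epsilon> < T \<longrightarrow> abs_continuous_on c \<epsilon> T) \<and>
     (AE t in lebesgue. t \<in> {0<..T} \<longrightarrow>
        (c has_vector_derivative
           (- (1 / t)) *\<^sub>R (legs_A *v c t) + ((1 / t) * f t) *\<^sub>R legs_B) (at t within {0..T})) \<and>
     c 0 = f 0 *\<^sub>R e1"

text \<open>
  Each scheme below takes the step size \<open>h\<close> and the input \<open>f\<close>. Only the iterates with index at
  most \<open>n\<close> are relevant when \<open>h = T / n\<close>.
\<close>

primrec forward_euler :: "real \<Rightarrow> (real \<Rightarrow> real) \<Rightarrow> nat \<Rightarrow> real ^ 'n::{finite,wellorder}" where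
  "forward_euler h f 0 = f 0 *\<^sub>R e1"
| "forward_euler h f (Suc k) =
     (if k = 0 then forward_euler h f k
      else (mat 1 - (1 / real k) *\<^sub>R legs_A) *v forward_euler h f k
         + ((1 / real k) * f (real k * h)) *\<^sub>R legs_B)"

primrec backward_euler :: "real \<Rightarrow> (real \<Rightarrow> real) \<Rightarrow> nat \<Rightarrow> real ^ 'n::{finite,wellorder}" where
  "backward_euler h f 0 = f 0 *\<^sub>R e1"
| "backward_euler h f (Suc k) =
     matrix_inv (mat 1 + (1 / real (k + 1)) *\<^sub>R legs_A) *v backward_euler h f k
     + matrix_inv (mat 1 + (1 / real (k + 1)) *\<^sub>R legs_A) *v
         (((1 / real (k + 1)) * f (real (k + 1) * h)) *\<^sub>R legs_B)"

primrec bilinear_scheme :: "real \<Rightarrow> (real \<Rightarrow> real) \<Rightarrow> nat \<Rightarrow> real ^ 'n::{finite,wellorder}" where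
  "bilinear_scheme h f 0 = f 0 *\<^sub>R e1"
| "bilinear_scheme h f (Suc k) =
     (if k = 0 then
        matrix_inv (mat 1 + (1 / 2) *\<^sub>R legs_A) *v bilinear_scheme h f k
        + (1 / 2) *\<^sub>R (matrix_inv (mat 1 + (1 / 2) *\<^sub>R legs_A) *v (f h *\<^sub>R legs_B))
      else
        matrix_inv (mat 1 + (1 / (2 * real (k + 1))) *\<^sub>R legs_A) *v
          ((mat 1 - (1 / (2 * real k)) *\<^sub>R legs_A) *v bilinear_scheme h f k)
        + matrix_inv (mat 1 + (1 / (2 * real (k + 1))) *\<^sub>R legs_A) *v
          (((1 / (2 * real k)) * f (real k * h)
            + (1 / (2 * real (k + 1))) * f (real (k + 1) * h)) *\<^sub>R legs_B))"

primrec approx_bilinear_scheme :: "real \<Rightarrow> (real \<Rightarrow> real) \<Rightarrow> nat \<Rightarrow> real ^ 'n::{finite,wellorder}" where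
  "approx_bilinear_scheme h f 0 = f 0 *\<^sub>R e1"
| "approx_bilinear_scheme h f (Suc k) =
     matrix_inv (mat 1 + (1 / (2 * real (k + 1))) *\<^sub>R legs_A) *v
       ((mat 1 - (1 / (2 * real (k + 1))) *\<^sub>R legs_A) *v approx_bilinear_scheme h f k)
     + matrix_inv (mat 1 + (1 / (2 * real (k + 1))) *\<^sub>R legs_A) *v
       (((1 / real (k + 1)) * f (real (k + 1) * h)) *\<^sub>R legs_B)"

definition zoh_matrix :: "nat \<Rightarrow> real ^ 'n::{finite,wellorder} ^ 'n::{finite,wellorder}" where
  "zoh_matrix k = (if k = 0 then 0 else mat_exp (ln (real k / real (k + 1)) *\<^sub>R legs_A))"

primrec zero_order_hold :: "real \<Rightarrow> (real \<Rightarrow> real) \<Rightarrow> nat \<Rightarrow> real ^ 'n::{finite,wellorder}" where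
  "zero_order_hold h f 0 = f 0 *\<^sub>R e1"
| "zero_order_hold h f (Suc k) =
     zoh_matrix k *v zero_order_hold h f k
     + matrix_inv legs_A *v ((mat 1 - zoh_matrix k) *v (f (real k * h) *\<^sub>R legs_B))"

end

theory Submission
  imports Defs "HOL-Real_Asymp.Real_Asymp"
begin

text \<open>
  The matrix of the system is lower triangular with the distinct diagonal entries \<open>1, \<dots>, N\<close>, so its left
  eigenvectors span the space, and it is enough to test the error against one left eigenvector \<open>w\<close>
  with eigenvalue \<open>l \<ge> 1\<close>. Every matrix in the five schemes (affine functions of the system matrix,
  their inverses, the matrix exponential) has \<open>w\<close> as a left eigenvector as well, so the numbers
  \<open>y\<^sub>k = w \<bullet> c\<^sup>k\<close> satisfy a scalar recursion
  \<open>y\<^bsub>k+1\<^esub> = \<rho> k * y\<^sub>k + b * (p k * f\<^sub>k + q k * f\<^bsub>k+1\<^esub>)\<close> with \<open>\<rho> k = 1 - l / k + O(1 / k\<^sup>2)\<close>,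
  \<open>p k = \<theta> / k + O(1 / k\<^sup>2)\<close>, \<open>q k = (1 - \<theta>) / k + O(1 / k\<^sup>2)\<close> and \<open>b\<close> the component of the input vector.

  For such a recursion the iterates are bounded uniformly in the mesh (\<open>damped_recurrence_bounded\<close>),
  and telescoping \<open>k\<^sup>l y\<^sub>k\<close> shows that \<open>y\<^sub>n\<close> is, up to an error \<open>O(log n / n)\<close>, the weighted sum
  \<open>b n\<^bsup>-l\<^esup> \<Sum> k\<^bsup>l-1\<^esup> (\<theta> f\<^sub>k + (1 - \<theta>) f\<^bsub>k+1\<^esub>)\<close> (\<open>one_step_scheme_approx_riemann_sum\<close>). This is a Riemann sum
  of \<open>s\<^bsup>l-1\<^esup> f\<close> in which the weight and \<open>f\<close> are sampled at possibly different points of a mesh interval;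
  it converges by the Henstock lemma with constant gauges, which is available because \<open>f\<close> is Riemann
  integrable (\<open>weighted_riemann_sums_tendsto\<close>). The limit is \<open>b T\<^bsup>-l\<^esup> \<integral> s\<^bsup>l-1\<^esup> f(s) ds\<close> over \<open>{0..T}\<close>.

  The exact solution has the same value: \<open>t\<^sup>l (w \<bullet> c t)\<close> is absolutely continuous away from \<open>0\<close>, its
  derivative is almost everywhere \<open>b t\<^bsup>l-1\<^esup> f\<close>, and it vanishes at \<open>0\<close>
  (\<open>has_integral_deriv_of_abs_continuous\<close>, \<open>legs_solution_left_eigen\<close>). Neither side retains the
  initial value.
\<close>

section \<open>Scalar one-step recursions\<close>

text \<open>
  An eventual bound on a sequence becomes a bound valid for every index when the comparison
  sequence is positive; the constant absorbs the finitely many exceptional ratios.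
\<close>

lemma bigo_seq_imp_uniform_bound:
  fixes f g :: "nat \<Rightarrow> real"
  assumes "f \<in> O(g)" and "\<And>k. g k > 0"
  obtains C where "C \<ge> 0" "\<And>k. \<bar>f k\<bar> \<le> C * g k"
proof -
  from assms(1) obtain c where "c > 0" "\<forall>\<^sub>F k in at_top. \<bar>f k\<bar> \<le> c * \<bar>g k\<bar>"
    by (auto elim: landau_o.bigE)
  then obtain N where N: "\<And>k. k \<ge> N \<Longrightarrow> \<bar>f k\<bar> \<le> c * g k"
    using assms(2) by (auto simp: eventually_at_top_linorder abs_of_pos)
  let ?C = "c + (\<Sum>k<N. \<bar>f k\<bar> / g k)"
  have nn: "0 \<le> \<bar>f k\<bar> / g k" for k
    using assms(2)[of k] by simp
  show thesis
  proof (rule that[of ?C])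
    show "?C \<ge> 0" using \<open>c > 0\<close> nn by (intro add_nonneg_nonneg sum_nonneg) auto
    fix k
    have "\<bar>f k\<bar> / g k \<le> ?C"
    proof (cases "k < N")
      case True
      then have "\<bar>f k\<bar> / g k \<le> (\<Sum>k<N. \<bar>f k\<bar> / g k)"
        using nn by (intro member_le_sum) auto
      with \<open>c > 0\<close> show ?thesis by linarith
    next
      case False
      then have "\<bar>f k\<bar> / g k \<le> c"
        using N[of k] assms(2)[of k] by (simp add: divide_simps)
      moreover have "0 \<le> (\<Sum>k<N. \<bar>f k\<bar> / g k)" using nn by (intro sum_nonneg) auto
      ultimately show ?thesis by linarith
    qed
    then show "\<bar>f k\<bar> \<le> ?C * g k"
      using assms(2)[of k] by (simp add: pos_divide_le_eq)
  qed
qed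

text \<open>
  Stability. Since \<open>l \<ge> 1\<close>, the factor \<open>\<bar>\<rho> k\<bar>\<close> is at most \<open>1 - 1 / (2 (k + 1))\<close> for large
  \<open>k\<close>, and this damping balances a forcing of size \<open>D / (k + 1)\<close> once the bound is at least
  \<open>2 D\<close>. It is uniform in the mesh parameter \<open>n\<close>, because the finitely many earlier iterates have
  bounds that do not depend on \<open>n\<close>.
\<close>

lemma damped_recurrence_bounded:
  fixes \<rho> :: "nat \<Rightarrow> real" and y r :: "nat \<Rightarrow> nat \<Rightarrow> real" and l D Y :: real
  assumes "l \<ge> 1"
    and \<rho>: "(\<lambda>k. \<rho> k - 1 + l / real k) \<in> O(\<lambda>k. 1 / (real k)\<^sup>2)"
    and y0: "\<And>n. \<bar>y n 0\<bar> \<le> Y"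
    and y: "\<And>n k. k < n \<Longrightarrow> y n (Suc k) = \<rho> k * y n k + r n k"
    and r: "\<And>n k. k < n \<Longrightarrow> \<bar>r n k\<bar> \<le> D / real (Suc k)"
  obtains K where "K \<ge> 0" "\<And>n k. k \<le> n \<Longrightarrow> \<bar>y n k\<bar> \<le> K"
proof -
  have "D \<ge> 0" using r[of 0 1] by auto
  obtain C where "C > 0" and C: "\<forall>\<^sub>F k in at_top. \<bar>\<rho> k - 1 + l / real k\<bar> \<le> C * (1 / (real k)\<^sup>2)"
    using \<rho> by (auto elim!: landau_o.bigE)
  note C
  moreover have "\<forall>\<^sub>F k in at_top. 1 - l / real k - C * (1 / (real k)\<^sup>2) \<ge> 0"
    using \<open>l \<ge> 1\<close> \<open>C > 0\<close> by real_asymp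
  moreover have "\<forall>\<^sub>F k in at_top. 1 - l / real k + C * (1 / (real k)\<^sup>2) \<le> 1 - 1 / (2 * real (Suc k))"
  proof -
    have "\<forall>\<^sub>F k in at_top. 1 - 1 / real k + C * (1 / (real k)\<^sup>2) \<le> 1 - 1 / (2 * real (Suc k))"
      using \<open>C > 0\<close> by real_asymp
    then show ?thesis
    proof eventually_elim
      case (elim k)
      have "1 / real k \<le> l / real k" using \<open>l \<ge> 1\<close> by (intro divide_right_mono) auto
      with elim show ?case by linarith
    qed
  qed
  ultimately have "\<forall>\<^sub>F k in at_top. \<bar>\<rho> k\<bar> \<le> 1 - 1 / (2 * real (Suc k))"
    by eventually_elim linarith
  then obtain N where N: "\<And>k. k \<ge> N \<Longrightarrow> \<bar>\<rho> k\<bar> \<le> 1 - 1 / (2 * real (Suc k))"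
    by (auto simp: eventually_at_top_linorder)
  have "\<exists>G. \<forall>k\<le>j. \<forall>n\<ge>k. \<bar>y n k\<bar> \<le> G" for j
  proof (induction j)
    case 0
    then show ?case using y0 by auto
  next
    case (Suc j)
    then obtain G where G: "\<And>k n. k \<le> j \<Longrightarrow> n \<ge> k \<Longrightarrow> \<bar>y n k\<bar> \<le> G" by blast
    have "\<bar>y n (Suc j)\<bar> \<le> \<bar>\<rho> j\<bar> * G + D" if "n \<ge> Suc j" for n
    proof -
      have "\<bar>y n (Suc j)\<bar> \<le> \<bar>\<rho> j\<bar> * \<bar>y n j\<bar> + \<bar>r n j\<bar>"
        using y[of j n] that by (simp add: abs_mult[symmetric])
      also have "\<dots> \<le> \<bar>\<rho> j\<bar> * G + D / real (Suc j)"
        using that by (intro add_mono mult_left_mono G r) auto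
      also have "D / real (Suc j) \<le> D"
        using \<open>D \<ge> 0\<close> by (simp add: divide_le_eq mult_le_cancel_left1)
      finally show ?thesis by simp
    qed
    then show ?case
      using G by (intro exI[of _ "max G (\<bar>\<rho> j\<bar> * G + D)"]) (auto simp: le_Suc_eq le_max_iff_disj)
  qed
  then obtain G where G: "\<And>k n. k \<le> N \<Longrightarrow> n \<ge> k \<Longrightarrow> \<bar>y n k\<bar> \<le> G" by blast
  let ?K = "max G (2 * D)"
  have "\<bar>y n k\<bar> \<le> ?K" if "k \<le> n" for n k
    using that
  proof (induction k)
    case 0
    then show ?case using G[of 0 n] by auto
  next
    case (Suc k)
    show ?case
    proof (cases "k < N")
      case True
      then show ?thesis using G[of "Suc k" n] Suc.prems by auto
    next
      case False
      have "\<bar>y n (Suc k)\<bar> \<le> \<bar>\<rho> k\<bar> * \<bar>y n k\<bar> + \<bar>r n k\<bar>"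
        using y[of k n] Suc.prems by (simp add: abs_mult[symmetric])
      also have "\<dots> \<le> (1 - 1 / (2 * real (Suc k))) * ?K + D / real (Suc k)"
        using Suc False N[of k] by (intro add_mono mult_mono r) (auto simp: divide_simps)
      also have "\<dots> = ?K - (?K - 2 * D) / (2 * real (Suc k))"
        by (simp add: divide_simps del: of_nat_Suc) (simp add: algebra_simps del: of_nat_Suc)
      also have "\<dots> \<le> ?K" by simp
      finally show ?thesis .
    qed
  qed
  then show thesis using \<open>D \<ge> 0\<close> by (intro that[of ?K]) auto
qed

lemma harm_over_n_tendsto_0: "(\<lambda>n. harm n / real n :: real) \<longlonglongrightarrow> 0"
proof -
  have "(\<lambda>n. (harm n - ln (real n)) * (1 / real n) + ln (real n) / real n) \<longlonglongrightarrow>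
      euler_mascheroni * 0 + (0::real)"
    by (intro tendsto_intros euler_mascheroni_LIMSEQ)
  moreover have "(harm n - ln (real n)) * (1 / real n) + ln (real n) / real n = harm n / real n" for n
    by (cases "n = 0") (auto simp: field_simps)
  ultimately show ?thesis by simp
qed

lemma power_ratio_expansion:
  "(\<lambda>k. (real k / real (Suc k)) ^ l - 1 + real l / real k) \<in> O(\<lambda>k. 1 / (real k)\<^sup>2)"
proof (cases "l = 0")
  case False
  then have "real l > 0" by simp
  then have "(\<lambda>k. (real k / real (Suc k)) powr real l - 1 + real l / real k) \<in> O(\<lambda>k. 1 / (real k)\<^sup>2)"
    by real_asymp
  also have "?this \<longleftrightarrow> ?thesis"
    by (intro landau_o.big.in_cong eventually_mono[OF eventually_gt_at_top[of 0]])
       (auto simp: powr_realpow)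
  finally show ?thesis .
qed simp

text \<open>
  The integrating factor \<open>(k + 1)\<^sup>l\<close> turns a step weight \<open>\<theta> / k + O(1 / k\<^sup>2)\<close> into
  \<open>\<theta> k\<^bsup>l-1\<^esup> + O(k\<^bsup>l-2\<^esup>)\<close>. The error is written as \<open>(k + 1)\<^sup>l / (k + 1)\<^sup>2\<close>, which is positive also
  at \<open>k = 0\<close>.
\<close>

lemma weight_expansion:
  assumes "l \<ge> 1" and "(\<lambda>k. p k - \<theta> / real k) \<in> O(\<lambda>k. 1 / (real k)\<^sup>2)"
  shows "(\<lambda>k. real (Suc k) ^ l * p k - \<theta> * real k ^ (l - 1)) \<in>
    O(\<lambda>k. real (Suc k) ^ l / (real (Suc k))\<^sup>2)"
proof -
  let ?R = "\<lambda>k. (real k / real (Suc k)) ^ l - 1 + real l / real k"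
  have "(\<lambda>k. ?R k * (1 / real k)) \<in> O(\<lambda>k. 1 / (real k)\<^sup>2 * 1)"
    by (rule landau_o.big.mult[OF power_ratio_expansion]) real_asymp
  moreover have "(\<lambda>k. real l / (real k)\<^sup>2) \<in> O(\<lambda>k. 1 / (real k)\<^sup>2)"
    using assms(1) by real_asymp
  ultimately have "(\<lambda>k. (p k - \<theta> / real k) + \<theta> * (real l / (real k)\<^sup>2 - ?R k * (1 / real k))) \<in>
      O(\<lambda>k. 1 / (real k)\<^sup>2)"
    by (intro sum_in_bigo(1)[OF assms(2)]) (cases "\<theta> = 0"; auto intro!: sum_in_bigo(2) simp del: of_nat_Suc)
  also have "(\<lambda>k. 1 / (real k)\<^sup>2) \<in> O(\<lambda>k. 1 / (real (Suc k))\<^sup>2)"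
    by real_asymp
  finally have "(\<lambda>k. real (Suc k) ^ l * ((p k - \<theta> / real k) + \<theta> * (real l / (real k)\<^sup>2 - ?R k * (1 / real k)))) \<in>
      O(\<lambda>k. real (Suc k) ^ l * (1 / (real (Suc k))\<^sup>2))"
    by (intro landau_o.big.mult) auto
  also have "?this \<longleftrightarrow> ?thesis"
  proof (intro landau_o.big.cong_ex eventually_mono[OF eventually_gt_at_top[of 0]])
    fix k :: nat assume "0 < k"
    obtain m where m: "l = Suc m" using assms(1) by (cases l) auto
    let ?z = "1 / real k * (real k / real (Suc k)) ^ l"
    have "real (Suc k) ^ l * ?z = real k ^ (l - 1)"
      using \<open>0 < k\<close> by (simp add: m power_divide)
    moreover have "real l / (real k)\<^sup>2 - ?R k * (1 / real k) = 1 / real k - ?z"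
      using \<open>0 < k\<close> by (simp add: field_simps power2_eq_square)
    moreover have "a * ((x - \<theta> / real k) + \<theta> * (1 / real k - z)) = a * x - \<theta> * (a * z)" for a x z
      by (simp add: algebra_simps)
    ultimately show "real (Suc k) ^ l * ((p k - \<theta> / real k) + \<theta> * (real l / (real k)\<^sup>2 - ?R k * (1 / real k)))
      = real (Suc k) ^ l * p k - \<theta> * real k ^ (l - 1)"
      by (simp only:)
  qed auto
  finally show ?thesis .
qed

lemma weight_bigo:
  assumes "(\<lambda>k. p k - \<theta> / real k) \<in> O(\<lambda>k. 1 / (real k)\<^sup>2)"
  shows "p \<in> O(\<lambda>k. 1 / real (Suc k))"
proof -
  have "(\<lambda>k. 1 / (real k)\<^sup>2) \<in> O(\<lambda>k. 1 / real (Suc k))" by real_asymp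
  with assms have "(\<lambda>k. p k - \<theta> / real k) \<in> O(\<lambda>k. 1 / real (Suc k))"
    by (rule landau_o.big_trans)
  moreover have "(\<lambda>k. \<theta> * (1 / real k)) \<in> O(\<lambda>k. 1 / real (Suc k))"
  proof -
    have "(\<lambda>k. 1 / real k) \<in> O(\<lambda>k. 1 / real (Suc k))" by real_asymp
    then have "(\<lambda>k. \<theta> * (1 / real k)) \<in> O(\<lambda>k. 1 * (1 / real (Suc k)))"
      by (intro landau_o.big.mult) auto
    then show ?thesis by simp
  qed
  ultimately have "(\<lambda>k. (p k - \<theta> / real k) + \<theta> * (1 / real k)) \<in> O(\<lambda>k. 1 / real (Suc k))"
    by (rule sum_in_bigo)
  then show ?thesis by simp
qed

text \<open>
  Multiplied by the integrating factor \<open>k\<^sup>l\<close>, which vanishes at \<open>k = 0\<close>, the recursion telescopes. The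
  increment of \<open>k\<^sup>l y\<^sub>k\<close> is \<open>b k\<^bsup>l-1\<^esup>\<close> times a weighted mean of two neighbouring samples, up to
  \<open>O(k\<^bsup>l-2\<^esup>)\<close>, and these errors add up to \<open>O(n\<^bsup>l-1\<^esup> harm n)\<close>, which is negligible against \<open>n\<^sup>l\<close>.
  The initial value contributes only through the bound on the iterates.
\<close>

lemma one_step_scheme_approx_riemann_sum:
  fixes \<rho> p q :: "nat \<Rightarrow> real" and y F :: "nat \<Rightarrow> nat \<Rightarrow> real" and \<theta> b M v :: real
  assumes "l \<ge> 1"
    and \<rho>: "(\<lambda>k. \<rho> k - 1 + real l / real k) \<in> O(\<lambda>k. 1 / (real k)\<^sup>2)"
    and p: "(\<lambda>k. p k - \<theta> / real k) \<in> O(\<lambda>k. 1 / (real k)\<^sup>2)"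
    and q: "(\<lambda>k. q k - (1 - \<theta>) / real k) \<in> O(\<lambda>k. 1 / (real k)\<^sup>2)"
    and F: "\<And>n k. k \<le> n \<Longrightarrow> \<bar>F n k\<bar> \<le> M"
    and y0: "\<And>n. y n 0 = v"
    and y: "\<And>n k. k < n \<Longrightarrow> y n (Suc k) = \<rho> k * y n k + b * (p k * F n k + q k * F n (Suc k))"
  shows "(\<lambda>n. y n n - b / real n ^ l *
    (\<Sum>k<n. real k ^ (l - 1) * (\<theta> * F n k + (1 - \<theta>) * F n (Suc k)))) \<longlonglongrightarrow> 0"
proof -
  have "M \<ge> 0" using F[of 0 0] by auto
  obtain Cp where Cp: "Cp \<ge> 0" "\<And>k. \<bar>p k\<bar> \<le> Cp * (1 / real (Suc k))"
    using bigo_seq_imp_uniform_bound[OF weight_bigo[OF p]] by (metis of_nat_0_less_iff zero_less_Suc zero_less_divide_1_iff)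
  obtain Cq where Cq: "Cq \<ge> 0" "\<And>k. \<bar>q k\<bar> \<le> Cq * (1 / real (Suc k))"
    using bigo_seq_imp_uniform_bound[OF weight_bigo[OF q]] by (metis of_nat_0_less_iff zero_less_Suc zero_less_divide_1_iff)
  have "\<bar>b * (p k * F n k + q k * F n (Suc k))\<bar> \<le> \<bar>b\<bar> * (Cp + Cq) * M / real (Suc k)" if "k < n" for n k
  proof -
    have "\<bar>p k * F n k + q k * F n (Suc k)\<bar> \<le> \<bar>p k\<bar> * \<bar>F n k\<bar> + \<bar>q k\<bar> * \<bar>F n (Suc k)\<bar>"
      by (simp add: abs_mult[symmetric])
    also have "\<dots> \<le> Cp * (1 / real (Suc k)) * M + Cq * (1 / real (Suc k)) * M"
      using that Cp Cq \<open>M \<ge> 0\<close> by (intro add_mono mult_mono F) auto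
    also have "\<dots> = (Cp + Cq) * M / real (Suc k)" by (simp add: add_divide_distrib distrib_right)
    finally show ?thesis by (simp add: abs_mult mult_left_mono mult.assoc flip: times_divide_eq_right)
  qed
  note r = this
  obtain K where K: "K \<ge> 0" "\<And>n k. k \<le> n \<Longrightarrow> \<bar>y n k\<bar> \<le> K"
  proof (rule damped_recurrence_bounded)
    show "real l \<ge> 1" using \<open>l \<ge> 1\<close> by simp
    show "\<bar>y n 0\<bar> \<le> \<bar>v\<bar>" for n using y0 by simp
  qed (rule \<rho> y r that; assumption)+

  \<comment> \<open>Deviations of the coefficients after multiplication by the integrating factor.\<close>
  let ?G = "\<lambda>k. real (Suc k) ^ l / (real (Suc k))\<^sup>2"
  let ?\<alpha> = "\<lambda>k. real (Suc k) ^ l * \<rho> k - real k ^ l"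
  let ?\<beta> = "\<lambda>k. real (Suc k) ^ l * p k - \<theta> * real k ^ (l - 1)"
  let ?\<gamma> = "\<lambda>k. real (Suc k) ^ l * q k - (1 - \<theta>) * real k ^ (l - 1)"
  have Gpos: "?G k > 0" for k by simp
  have "(\<lambda>k. (\<rho> k - 1 + real l / real k) - ((real k / real (Suc k)) ^ l - 1 + real l / real k)) \<in>
      O(\<lambda>k. 1 / (real k)\<^sup>2)"
    by (rule sum_in_bigo(2)[OF \<rho> power_ratio_expansion])
  also have "(\<lambda>k. 1 / (real k)\<^sup>2) \<in> O(\<lambda>k. 1 / (real (Suc k))\<^sup>2)" by real_asymp
  finally have "(\<lambda>k. real (Suc k) ^ l * ((\<rho> k - 1 + real l / real k) -
      ((real k / real (Suc k)) ^ l - 1 + real l / real k))) \<in> O(\<lambda>k. real (Suc k) ^ l * (1 / (real (Suc k))\<^sup>2))"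
    by (intro landau_o.big.mult) auto
  then have "?\<alpha> \<in> O(?G)" by (simp add: right_diff_distrib power_divide del: of_nat_Suc)
  from bigo_seq_imp_uniform_bound[OF this Gpos]
  obtain C1 where C1: "C1 \<ge> 0" "\<And>k. \<bar>?\<alpha> k\<bar> \<le> C1 * ?G k" by blast
  from bigo_seq_imp_uniform_bound[OF weight_expansion[OF \<open>l \<ge> 1\<close> p] Gpos]
  obtain C2 where C2: "C2 \<ge> 0" "\<And>k. \<bar>?\<beta> k\<bar> \<le> C2 * ?G k" by blast
  from bigo_seq_imp_uniform_bound[OF weight_expansion[OF \<open>l \<ge> 1\<close> q] Gpos]
  obtain C3 where C3: "C3 \<ge> 0" "\<And>k. \<bar>?\<gamma> k\<bar> \<le> C3 * ?G k" by blast
  define E where "E = C1 * K + \<bar>b\<bar> * (C2 * M + C3 * M)"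
  have E_eq: "C1 * g * K + \<bar>b\<bar> * (C2 * g * M + C3 * g * M) = E * g" for g
    unfolding E_def by (simp add: algebra_simps)
  have "E \<ge> 0" unfolding E_def using C1 C2 C3 K \<open>M \<ge> 0\<close> by simp

  have step: "\<bar>(real (Suc k) ^ l * y n (Suc k) - real k ^ l * y n k)
      - b * (real k ^ (l - 1) * (\<theta> * F n k + (1 - \<theta>) * F n (Suc k)))\<bar> \<le> E * ?G k" if "k < n" for n k
  proof -
    let ?d = "(real (Suc k) ^ l * y n (Suc k) - real k ^ l * y n k)
      - b * (real k ^ (l - 1) * (\<theta> * F n k + (1 - \<theta>) * F n (Suc k)))"
    have "?d = ?\<alpha> k * y n k + b * (?\<beta> k * F n k + ?\<gamma> k * F n (Suc k))"
      unfolding y[OF that] by (simp add: algebra_simps)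
    then have "\<bar>?d\<bar> = \<bar>?\<alpha> k * y n k + b * (?\<beta> k * F n k + ?\<gamma> k * F n (Suc k))\<bar>"
      by (rule arg_cong)
    also have "\<dots> \<le> \<bar>?\<alpha> k * y n k\<bar> + \<bar>b * (?\<beta> k * F n k + ?\<gamma> k * F n (Suc k))\<bar>"
      by (rule abs_triangle_ineq)
    also have "\<dots> \<le> \<bar>?\<alpha> k\<bar> * \<bar>y n k\<bar> + \<bar>b\<bar> * (\<bar>?\<beta> k\<bar> * \<bar>F n k\<bar> + \<bar>?\<gamma> k\<bar> * \<bar>F n (Suc k)\<bar>)"
      using mult_left_mono[OF abs_triangle_ineq[of "?\<beta> k * F n k" "?\<gamma> k * F n (Suc k)"], of "\<bar>b\<bar>"]
      by (simp only: abs_mult abs_ge_zero add_le_cancel_left)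
    also have "\<dots> \<le> C1 * ?G k * K + \<bar>b\<bar> * (C2 * ?G k * M + C3 * ?G k * M)"
    proof -
      have "\<bar>?\<alpha> k\<bar> * \<bar>y n k\<bar> \<le> C1 * ?G k * K"
        using that by (intro mult_mono C1 K mult_nonneg_nonneg less_imp_le[OF Gpos]) auto
      moreover have "\<bar>?\<beta> k\<bar> * \<bar>F n k\<bar> \<le> C2 * ?G k * M"
        using that by (intro mult_mono C2 F mult_nonneg_nonneg less_imp_le[OF Gpos]) auto
      moreover have "\<bar>?\<gamma> k\<bar> * \<bar>F n (Suc k)\<bar> \<le> C3 * ?G k * M"
        using that by (intro mult_mono C3 F mult_nonneg_nonneg less_imp_le[OF Gpos]) auto
      ultimately show ?thesis by (intro add_mono mult_left_mono) auto
    qed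
    also have "\<dots> = E * ?G k" by (rule E_eq)
    finally show ?thesis .
  qed

  have sumG: "(\<Sum>k<n. ?G k) \<le> real n ^ (l - 1) * harm n" for n
  proof -
    have "?G k \<le> real n ^ (l - 1) * inverse (real (Suc k))" if "k < n" for k
    proof -
      obtain m where m: "l = Suc m" using assms(1) by (cases l) auto
      have "?G k = real (Suc k) ^ m * inverse (real (Suc k))"
        by (simp add: m field_simps power2_eq_square del: of_nat_Suc)
      also have "\<dots> \<le> real n ^ m * inverse (real (Suc k))"
        using that by (intro mult_right_mono power_mono) auto
      finally show ?thesis by (simp add: m)
    qed
    then have "(\<Sum>k<n. ?G k) \<le> (\<Sum>k<n. real n ^ (l - 1) * inverse (real (Suc k)))"
      by (intro sum_mono) auto
    also have "\<dots> = real n ^ (l - 1) * harm n"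
      unfolding harm_def sum_distrib_left[symmetric]
      by (simp add: sum.atLeast1_atMost_eq)
    finally show ?thesis .
  qed

  have bound: "\<bar>y n n - b / real n ^ l *
      (\<Sum>k<n. real k ^ (l - 1) * (\<theta> * F n k + (1 - \<theta>) * F n (Suc k)))\<bar> \<le> E * (harm n / real n)"
    if "n > 0" for n
  proof -
    let ?S = "\<Sum>k<n. real k ^ (l - 1) * (\<theta> * F n k + (1 - \<theta>) * F n (Suc k))"
    have "real n ^ l * y n n = (\<Sum>k<n. real (Suc k) ^ l * y n (Suc k) - real k ^ l * y n k)"
      using sum_lessThan_telescope[of "\<lambda>k. real k ^ l * y n k" n] \<open>l \<ge> 1\<close> by (simp add: power_0_left)
    then have eq: "real n ^ l * y n n - b * ?S = (\<Sum>k<n. (real (Suc k) ^ l * y n (Suc k) - real k ^ l * y n k)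
      - b * (real k ^ (l - 1) * (\<theta> * F n k + (1 - \<theta>) * F n (Suc k))))"
      by (simp only: sum_subtractf sum_distrib_left)
    have "\<bar>real n ^ l * y n n - b * ?S\<bar> \<le> (\<Sum>k<n. E * ?G k)"
      unfolding eq by (rule order_trans[OF sum_abs]) (intro sum_mono step, simp)
    also have "\<dots> \<le> E * (real n ^ (l - 1) * harm n)"
      unfolding sum_distrib_left[symmetric] using \<open>E \<ge> 0\<close> sumG by (rule mult_left_mono[rotated])
    finally have "\<bar>real n ^ l * y n n - b * ?S\<bar> \<le> E * (real n ^ (l - 1) * harm n)" .
    then have "\<bar>real n ^ l * y n n - b * ?S\<bar> / real n ^ l \<le> E * (real n ^ (l - 1) * harm n) / real n ^ l"
      by (intro divide_right_mono) auto
    moreover have "\<bar>real n ^ l * y n n - b * ?S\<bar> / real n ^ l = \<bar>y n n - b / real n ^ l * ?S\<bar>"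
    proof -
      have "(real n ^ l * y n n - b * ?S) / real n ^ l = y n n - b / real n ^ l * ?S"
        using that by (simp add: diff_divide_distrib)
      then have "\<bar>(real n ^ l * y n n - b * ?S) / real n ^ l\<bar> = \<bar>y n n - b / real n ^ l * ?S\<bar>"
        by (rule arg_cong)
      then show ?thesis by (simp only: abs_divide abs_of_nonneg[OF zero_le_power[OF of_nat_0_le_iff]])
    qed
    moreover have "E * (real n ^ (l - 1) * harm n) / real n ^ l = E * (harm n / real n)"
      using that assms(1) by (cases l) auto
    ultimately show ?thesis by (simp only:)
  qed
  have "(\<lambda>n. E * (harm n / real n)) \<longlonglongrightarrow> E * 0"
    by (intro tendsto_intros harm_over_n_tendsto_0)
  then have "(\<lambda>n. E * (harm n / real n)) \<longlonglongrightarrow> 0" by simp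
  then show ?thesis
    by (rule Lim_null_comparison[rotated])
       (use bound in \<open>auto intro: eventually_mono[OF eventually_gt_at_top[of 0]]\<close>)
qed

section \<open>Weighted Riemann sums\<close>

text \<open>
  A Riemann integrable function is gauge integrable with constant gauges, so the Henstock lemma
  holds with a gauge that depends on the accuracy only.
\<close>

lemma riemann_integrable_on_uniform_Henstock:
  assumes "a \<le> b" and riem: "riemann_integrable_on f a b"
  shows "f integrable_on {a..b}"
    and "\<And>e. e > 0 \<Longrightarrow> \<exists>\<delta>>0. \<forall>p. p tagged_partial_division_of {a..b} \<and> (\<forall>(x, K)\<in>p. K \<subseteq> ball x \<delta>) \<longrightarrow>
        (\<Sum>(x, K)\<in>p. \<bar>measure lborel K * f x - integral K f\<bar>) \<le> e"
proof -
  from riem obtain I where I: "\<forall>e>0. \<exists>\<delta>>0. \<forall>p. p tagged_division_of {a..b} \<and> (\<forall>(x, K)\<in>p. measure lborel K < \<delta>) \<longrightarrow>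
        \<bar>(\<Sum>(x, K)\<in>p. measure lborel K * f x) - I\<bar> < e"
    unfolding riemann_integrable_on_def by (elim exE)
  have fine: "\<exists>\<delta>>0. \<forall>p. p tagged_division_of cbox a b \<and> (\<lambda>x. ball x \<delta>) fine p \<longrightarrow>
        norm ((\<Sum>(x, K)\<in>p. measure lborel K *\<^sub>R f x) - I) < e" if e: "e > 0" for e
  proof -
    obtain \<delta> where "\<delta> > 0" and \<delta>: "\<forall>p. p tagged_division_of {a..b} \<and> (\<forall>(x, K)\<in>p. measure lborel K < \<delta>) \<longrightarrow>
        \<bar>(\<Sum>(x, K)\<in>p. measure lborel K * f x) - I\<bar> < e"
      using I[rule_format, OF e] by (elim exE conjE)
    have "norm ((\<Sum>(x, K)\<in>p. measure lborel K *\<^sub>R f x) - I) < e"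
      if p: "p tagged_division_of cbox a b" "(\<lambda>x. ball x (\<delta> / 2)) fine p" for p
    proof -
      have "measure lborel K < \<delta>" if xK: "(x, K) \<in> p" for x K
      proof -
        obtain u v where K: "K = {u..v}" using tagged_division_ofD(4)[OF p(1) xK] by auto
        have "u \<le> v" using tagged_division_ofD(2)[OF p(1) xK] by (auto simp: K)
        then have "u \<in> ball x (\<delta> / 2)" "v \<in> ball x (\<delta> / 2)" using fineD[OF p(2) xK] by (auto simp: K)
        then have "\<bar>x - u\<bar> < \<delta> / 2" "\<bar>x - v\<bar> < \<delta> / 2" by (simp_all only: mem_ball dist_real_def)
        then have "v - u < \<delta>" by arith
        then show ?thesis using \<open>u \<le> v\<close> by (simp add: K)
      qed
      then show ?thesis using \<delta>[rule_format, of p] p(1) by auto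
    qed
    then show ?thesis using \<open>\<delta> > 0\<close> by (intro exI[of _ "\<delta> / 2"]) auto
  qed
  have "(f has_integral I) (cbox a b)"
    unfolding has_integral
  proof (intro allI impI)
    fix e :: real assume "e > 0"
    from fine[OF this] obtain \<delta> where "\<delta> > 0" "\<forall>p. p tagged_division_of cbox a b \<and> (\<lambda>x. ball x \<delta>) fine p \<longrightarrow>
        norm ((\<Sum>(x, K)\<in>p. measure lborel K *\<^sub>R f x) - I) < e" by (elim exE conjE)
    then show "\<exists>\<gamma>. gauge \<gamma> \<and> (\<forall>p. p tagged_division_of cbox a b \<and> \<gamma> fine p \<longrightarrow>
        norm ((\<Sum>(x, K)\<in>p. measure lborel K *\<^sub>R f x) - I) < e)"
      by (intro exI[of _ "\<lambda>x. ball x \<delta>"] conjI gauge_ball)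
  qed
  then have int: "f integrable_on cbox a b" and Ieq: "integral (cbox a b) f = I" by auto
  from int show "f integrable_on {a..b}" by simp
  fix e :: real assume "e > 0"
  then have "e / 2 > 0" by simp
  from fine[OF this] obtain \<delta> where "\<delta> > 0" and \<delta>: "\<forall>p. p tagged_division_of cbox a b \<and> (\<lambda>x. ball x \<delta>) fine p \<longrightarrow>
        norm ((\<Sum>(x, K)\<in>p. measure lborel K *\<^sub>R f x) - I) < e / 2" by (elim exE conjE)
  have "(\<Sum>(x, K)\<in>p. norm (measure lborel K *\<^sub>R f x - integral K f)) \<le> 2 * real DIM(real) * (e / 2)"
    if "p tagged_partial_division_of {a..b}" "\<forall>(x, K)\<in>p. K \<subseteq> ball x \<delta>" for p
  proof (rule Henstock_lemma_part2[OF int \<open>e / 2 > 0\<close> gauge_ball[OF \<open>\<delta> > 0\<close>]])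
    show "norm ((\<Sum>(x, K)\<in>\<D>. measure lborel K *\<^sub>R f x) - integral (cbox a b) f) < e / 2"
      if "\<D> tagged_division_of cbox a b" "(\<lambda>x. ball x \<delta>) fine \<D>" for \<D>
      unfolding Ieq using \<delta> that by (elim allE impE) (rule conjI)
    show "p tagged_partial_division_of cbox a b" using that by simp
    show "(\<lambda>x. ball x \<delta>) fine p" using that(2) by (auto simp: fine_def)
  qed
  then show "\<exists>\<delta>>0. \<forall>p. p tagged_partial_division_of {a..b} \<and> (\<forall>(x, K)\<in>p. K \<subseteq> ball x \<delta>) \<longrightarrow>
        (\<Sum>(x, K)\<in>p. \<bar>measure lborel K * f x - integral K f\<bar>) \<le> e"
    using \<open>\<delta> > 0\<close> by (intro exI[of _ \<delta>]) simp
qed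

text \<open>
  The Henstock bound for the single tagged interval \<open>(x, {u..v})\<close>, whose length is bounded below
  independently of \<open>x\<close>, controls \<open>\<bar>f x\<bar>\<close> by the bounded indefinite integral.
\<close>

lemma riemann_integrable_on_imp_bounded:
  assumes "a < b" and riem: "riemann_integrable_on f a b"
  obtains M where "M \<ge> 0" "\<And>x. x \<in> {a..b} \<Longrightarrow> \<bar>f x\<bar> \<le> M"
proof -
  note H = riemann_integrable_on_uniform_Henstock[OF less_imp_le[OF \<open>a < b\<close>] riem]
  obtain \<delta> where "\<delta> > 0" and \<delta>: "\<forall>p. p tagged_partial_division_of {a..b} \<and> (\<forall>(x, K)\<in>p. K \<subseteq> ball x \<delta>) \<longrightarrow>
        (\<Sum>(x, K)\<in>p. \<bar>measure lborel K * f x - integral K f\<bar>) \<le> 1"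
    using H(2)[OF zero_less_one] by (elim exE conjE)
  have "compact ((\<lambda>x. integral {a..x} f) ` {a..b})"
    by (intro compact_continuous_image indefinite_integral_continuous_1 H(1)) auto
  then have "bounded ((\<lambda>x. integral {a..x} f) ` {a..b})" by (rule compact_imp_bounded)
  then obtain F where F': "\<forall>x\<in>{a..b}. \<bar>integral {a..x} f\<bar> \<le> F"
    by (auto simp: bounded_iff)
  note F = bspec[OF F']
  define \<eta> where "\<eta> = min (\<delta> / 2) ((b - a) / 2)"
  have "\<eta> > 0" using \<open>\<delta> > 0\<close> \<open>a < b\<close> by (simp add: \<eta>_def)
  have \<eta>_le: "2 * \<eta> \<le> b - a" "2 * \<eta> \<le> \<delta>" by (auto simp: \<eta>_def min_def)
  have "\<bar>f x\<bar> \<le> (1 + 2 * F) / \<eta>" if x: "x \<in> {a..b}" for x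
  proof -
    define u where "u = max a (x - \<eta>)"
    define v where "v = min b (x + \<eta>)"
    have uv: "a \<le> u" "u \<le> x" "x \<le> v" "v \<le> b" "\<eta> \<le> v - u"
      using x \<open>\<eta> > 0\<close> \<eta>_le by (auto simp: u_def v_def max_def min_def)
    have "{(x, {u..v})} tagged_partial_division_of {a..b}"
      using uv unfolding tagged_partial_division_of_def
      by (auto intro!: exI[of _ u] exI[of _ v])
    moreover have "{u..v} \<subseteq> ball x \<delta>"
      using \<open>\<delta> > 0\<close> \<eta>_le by (auto simp: u_def v_def dist_real_def)
    ultimately have "\<bar>measure lborel {u..v} * f x - integral {u..v} f\<bar> \<le> 1"
      using \<delta>[rule_format, of "{(x, {u..v})}"] by simp
    moreover have "integral {u..v} f = integral {a..v} f - integral {a..u} f"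
      using Henstock_Kurzweil_Integration.integral_combine[of a u v f] uv
        integrable_on_subinterval[OF H(1), of a v] by simp
    moreover have "\<bar>integral {a..v} f\<bar> \<le> F" "\<bar>integral {a..u} f\<bar> \<le> F"
      using uv by (auto intro!: F)
    moreover have "measure lborel {u..v} = v - u" using uv by simp
    moreover have "\<bar>(v - u) * f x\<bar> = (v - u) * \<bar>f x\<bar>" using uv by (simp add: abs_mult)
    ultimately have "(v - u) * \<bar>f x\<bar> \<le> 1 + 2 * F"
      by simp
    moreover have "\<eta> * \<bar>f x\<bar> \<le> (v - u) * \<bar>f x\<bar>"
      using uv by (intro mult_right_mono) auto
    ultimately show ?thesis using \<open>\<eta> > 0\<close> by (simp add: pos_le_divide_eq mult.commute)
  qed
  moreover have "F \<ge> 0" using F[of a] \<open>a < b\<close> by auto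
  ultimately show thesis using \<open>\<eta> > 0\<close> by (intro that[of "(1 + 2 * F) / \<eta>"]) auto
qed

lemma continuous_mult_riemann_integrable:
  assumes "a < b" and riem: "riemann_integrable_on f a b" and \<phi>: "continuous_on {a..b} \<phi>"
  shows "(\<lambda>x. \<phi> x * f x) integrable_on {a..b}"
proof -
  obtain M where M: "\<And>x. x \<in> {a..b} \<Longrightarrow> \<bar>f x\<bar> \<le> M"
    using riemann_integrable_on_imp_bounded[OF assms(1,2)] by metis
  have int: "f integrable_on {a..b}"
    using riemann_integrable_on_uniform_Henstock(1)[OF less_imp_le riem] \<open>a < b\<close> .
  have "f absolutely_integrable_on {a..b}"
    by (rule measurable_bounded_by_integrable_imp_absolutely_integrable[where g = "\<lambda>_. M"])
       (use int M in \<open>auto intro: integrable_imp_measurable\<close>)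
  moreover have "bounded (\<phi> ` {a..b})"
    using compact_continuous_image[OF \<phi>] by (simp add: compact_imp_bounded)
  ultimately have "(\<lambda>x. \<phi> x * f x) absolutely_integrable_on {a..b}"
    using \<phi> by (intro absolutely_integrable_bounded_measurable_product_real
        continuous_imp_measurable_on_sets_lebesgue) auto
  then show ?thesis by (rule set_lebesgue_integral_eq_integral(1))
qed

lemma integral_equidistant_sum:
  fixes g :: "real \<Rightarrow> real"
  assumes "h \<ge> 0" and "g integrable_on {0..real n * h}"
  shows "(\<Sum>k<n. integral {real k * h..real (Suc k) * h} g) = integral {0..real n * h} g"
  using assms(2)
proof (induction n)
  case (Suc n)
  have le: "0 \<le> real n * h" "real n * h \<le> real (Suc n) * h"
    using \<open>h \<ge> 0\<close> by (auto simp: mult_right_mono)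
  have "g integrable_on {0..real n * h}"
    by (rule integrable_on_subinterval[OF Suc.prems]) (use le in auto)
  then have "(\<Sum>k<Suc n. integral {real k * h..real (Suc k) * h} g) =
      integral {0..real n * h} g + integral {real n * h..real (Suc n) * h} g"
    using Suc.IH by simp
  also have "\<dots> = integral {0..real (Suc n) * h} g"
    by (rule Henstock_Kurzweil_Integration.integral_combine[OF le Suc.prems])
  finally show ?case .
qed simp

text \<open>
  The weight \<open>\<phi>\<close> is evaluated at the left endpoint of each mesh interval, while \<open>f\<close> is sampled at
  an arbitrary point of it. The Henstock bound replaces \<open>h f(\<xi>\<^sub>k)\<close> by the integral of \<open>f\<close> over the
  interval, and the uniform continuity of \<open>\<phi>\<close> moves the weight under that integral.
\<close>

lemma weighted_riemann_sums_tendsto: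
  fixes \<phi> f :: "real \<Rightarrow> real" and \<xi> :: "nat \<Rightarrow> nat \<Rightarrow> real"
  assumes "T > 0" and riem: "riemann_integrable_on f 0 T" and \<phi>: "continuous_on {0..T} \<phi>"
    and \<xi>: "\<And>n k. k < n \<Longrightarrow> \<xi> n k \<in> {real k * (T / real n)..real (Suc k) * (T / real n)}"
  shows "(\<lambda>n. T / real n * (\<Sum>k<n. \<phi> (real k * (T / real n)) * f (\<xi> n k))) \<longlonglongrightarrow>
    integral {0..T} (\<lambda>x. \<phi> x * f x)"
proof (rule metric_LIMSEQ_I)
  fix e :: real assume "e > 0"
  note H = riemann_integrable_on_uniform_Henstock[OF less_imp_le[OF \<open>T > 0\<close>] riem]
  note int\<phi>f = continuous_mult_riemann_integrable[OF \<open>T > 0\<close> riem \<phi>]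
  obtain M where "M \<ge> 0" and M: "\<And>x. x \<in> {0..T} \<Longrightarrow> \<bar>f x\<bar> \<le> M"
    using riemann_integrable_on_imp_bounded[OF \<open>T > 0\<close> riem] by metis
  have "compact (\<phi> ` {0..T})" using compact_continuous_image[OF \<phi>] by simp
  then have "bounded (\<phi> ` {0..T})" by (rule compact_imp_bounded)
  then obtain P where P': "\<forall>x\<in>{0..T}. \<bar>\<phi> x\<bar> \<le> P"
    by (auto simp: bounded_iff)
  note P = bspec[OF P']
  have "P \<ge> 0" using P[of 0] \<open>T > 0\<close> by auto
  define e1 where "e1 = e / (3 * (P + 1))"
  define e2 where "e2 = e / (3 * T * (M + 1))"
  have "e1 > 0" "e2 > 0" using \<open>e > 0\<close> \<open>P \<ge> 0\<close> \<open>M \<ge> 0\<close> \<open>T > 0\<close> by (simp_all add: e1_def e2_def)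
  obtain \<delta>1 where "\<delta>1 > 0" and \<delta>1: "\<forall>p. p tagged_partial_division_of {0..T} \<and> (\<forall>(x, K)\<in>p. K \<subseteq> ball x \<delta>1) \<longrightarrow>
        (\<Sum>(x, K)\<in>p. \<bar>measure lborel K * f x - integral K f\<bar>) \<le> e1"
    using H(2)[OF \<open>e1 > 0\<close>] by (elim exE conjE)
  have "uniformly_continuous_on {0..T} \<phi>"
    using \<phi> by (rule compact_uniformly_continuous) simp
  then obtain \<delta>2 where "\<delta>2 > 0" and \<delta>2: "\<And>x y. x \<in> {0..T} \<Longrightarrow> y \<in> {0..T} \<Longrightarrow> \<bar>y - x\<bar> < \<delta>2 \<Longrightarrow> \<bar>\<phi> y - \<phi> x\<bar> < e2"
    using \<open>e2 > 0\<close> unfolding uniformly_continuous_on_def dist_real_def by metis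
  obtain N :: nat where N: "T / min \<delta>1 \<delta>2 < real N" using reals_Archimedean2 by blast
  have "dist (T / real n * (\<Sum>k<n. \<phi> (real k * (T / real n)) * f (\<xi> n k))) (integral {0..T} (\<lambda>x. \<phi> x * f x)) < e"
    if "n \<ge> N" for n
  proof -
    define h where "h = T / real n"
    have "real N > 0" using N \<open>T > 0\<close> \<open>\<delta>1 > 0\<close> \<open>\<delta>2 > 0\<close> by (smt (verit) divide_pos_pos)
    then have "n > 0" using that by simp
    have "T / real n \<le> T / real N" using that \<open>real N > 0\<close> \<open>T > 0\<close> by (simp add: frac_le)
    also have "\<dots> < min \<delta>1 \<delta>2"
      using N \<open>real N > 0\<close> \<open>\<delta>1 > 0\<close> \<open>\<delta>2 > 0\<close> by (simp add: divide_less_eq mult.commute del: min_less_iff_conj)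
    finally have h: "h < \<delta>1" "h < \<delta>2" by (auto simp: h_def)
    have "h > 0" "real n * h = T" using \<open>n > 0\<close> \<open>T > 0\<close> by (auto simp: h_def)
    define I where "I k = {real k * h..real (Suc k) * h}" for k
    have Isub: "I k \<subseteq> {0..T}" if "k < n" for k
    proof -
      have "real (Suc k) * h \<le> real n * h" using that \<open>h > 0\<close> by (intro mult_right_mono) auto
      moreover have "0 \<le> real k * h" using \<open>h > 0\<close> by simp
      ultimately show ?thesis unfolding I_def \<open>real n * h = T\<close> by auto
    qed
    have Icontent: "measure lborel (I k) = h" for k
      using \<open>h > 0\<close> by (simp add: I_def algebra_simps)
    have \<xi>I: "\<xi> n k \<in> I k" if "k < n" for k using \<xi>[OF that] by (simp add: I_def h_def)
    have kI: "real k * h \<in> I k" for k using \<open>h > 0\<close> by (simp add: I_def)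
    have Idist: "\<bar>x - y\<bar> \<le> h" if "x \<in> I k" "y \<in> I k" for x y k
      using that by (auto simp: I_def algebra_simps)

    let ?p = "(\<lambda>k. (\<xi> n k, I k)) ` {..<n}"
    have disj: "interior (I j) \<inter> interior (I k) = {}" if "j < k" for j k
    proof -
      have "real (Suc j) * h \<le> real k * h" using that \<open>h > 0\<close> by (intro mult_right_mono) auto
      then show ?thesis by (auto simp: I_def)
    qed
    have inj: "inj_on (\<lambda>k. (\<xi> n k, I k)) {..<n}"
    proof (rule inj_onI)
      fix j k assume "(\<xi> n j, I j) = (\<xi> n k, I k)"
      then have eq: "I j = I k" by simp
      have "interior (I k) \<noteq> {}" using \<open>h > 0\<close> by (simp add: I_def)
      with eq disj[of j k] disj[of k j] show "j = k" by (cases j k rule: linorder_cases) auto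
    qed
    have "?p tagged_partial_division_of {0..T}"
      unfolding tagged_partial_division_of_def
    proof (intro conjI allI impI)
      fix x K assume "(x, K) \<in> ?p"
      then obtain k where k: "k < n" "x = \<xi> n k" "K = I k" by auto
      show "x \<in> K" using \<xi>I k by simp
      show "K \<subseteq> {0..T}" using Isub k by simp
      show "\<exists>u v. K = cbox u v" using k by (auto simp: I_def)
    next
      fix x K y J assume "(x, K) \<in> ?p \<and> (y, J) \<in> ?p \<and> (x, K) \<noteq> (y, J)"
      then obtain k j where "K = I k" "J = I j" "j \<noteq> k" by auto
      then show "interior K \<inter> interior J = {}"
        using disj[of j k] disj[of k j] by (cases j k rule: linorder_cases) auto
    qed simp
    moreover have "\<forall>(x, K)\<in>?p. K \<subseteq> ball x \<delta>1"
      using \<xi>I Idist h(1) by (fastforce simp: dist_real_def)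
    ultimately have "(\<Sum>(x, K)\<in>?p. \<bar>measure lborel K * f x - integral K f\<bar>) \<le> e1"
      by (intro \<delta>1[rule_format] conjI)
    then have Hen: "(\<Sum>k<n. \<bar>h * f (\<xi> n k) - integral (I k) f\<bar>) \<le> e1"
      by (subst (asm) sum.reindex[OF inj]) (simp add: Icontent)

    have local: "\<bar>h * (\<phi> (real k * h) * f (\<xi> n k)) - integral (I k) (\<lambda>x. \<phi> x * f x)\<bar> \<le>
        P * \<bar>h * f (\<xi> n k) - integral (I k) f\<bar> + e2 * M * h" if "k < n" for k
    proof -
      let ?c = "\<phi> (real k * h)"
      have i1: "f integrable_on I k" and i2: "(\<lambda>x. \<phi> x * f x) integrable_on I k"
        using Isub[OF that] unfolding I_def
        by (auto intro: integrable_on_subinterval[OF H(1)] integrable_on_subinterval[OF int\<phi>f])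
      have "((\<lambda>x. ?c * f x - \<phi> x * f x) has_integral ?c * integral (I k) f - integral (I k) (\<lambda>x. \<phi> x * f x))
          (cbox (real k * h) (real (Suc k) * h))"
        using i1 i2 unfolding I_def
        by (intro has_integral_diff has_integral_mult_right) (auto simp: has_integral_integral)
      moreover have "norm (?c * f x - \<phi> x * f x) \<le> e2 * M" if x: "x \<in> cbox (real k * h) (real (Suc k) * h)" for x
      proof -
        have "x \<in> I k" using x by (simp add: I_def)
        then have "\<bar>?c - \<phi> x\<bar> < e2" and "\<bar>f x\<bar> \<le> M"
          using Isub[OF \<open>k < n\<close>] kI[of k] Idist[of "real k * h" k x] h by (auto intro!: \<delta>2 M)
        then have "\<bar>?c - \<phi> x\<bar> * \<bar>f x\<bar> \<le> e2 * M" by (intro mult_mono) auto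
        then show ?thesis by (simp add: abs_mult[symmetric] left_diff_distrib)
      qed
      ultimately have "norm (?c * integral (I k) f - integral (I k) (\<lambda>x. \<phi> x * f x)) \<le>
          e2 * M * measure lborel (cbox (real k * h) (real (Suc k) * h))"
        using \<open>e2 > 0\<close> \<open>M \<ge> 0\<close> by (intro has_integral_bound) auto
      then have "\<bar>?c * integral (I k) f - integral (I k) (\<lambda>x. \<phi> x * f x)\<bar> \<le> e2 * M * h"
        using Icontent[of k] by (simp add: I_def)
      moreover have "\<bar>?c * (h * f (\<xi> n k) - integral (I k) f)\<bar> \<le> P * \<bar>h * f (\<xi> n k) - integral (I k) f\<bar>"
        unfolding abs_mult using P[of "real k * h"] Isub[OF that] kI[of k] by (intro mult_right_mono) auto
      moreover have "h * (?c * f (\<xi> n k)) - integral (I k) (\<lambda>x. \<phi> x * f x) =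
          ?c * (h * f (\<xi> n k) - integral (I k) f) + (?c * integral (I k) f - integral (I k) (\<lambda>x. \<phi> x * f x))"
        by (simp add: algebra_simps)
      ultimately show ?thesis by linarith
    qed
    have "integral {0..T} (\<lambda>x. \<phi> x * f x) = (\<Sum>k<n. integral (I k) (\<lambda>x. \<phi> x * f x))"
      using integral_equidistant_sum[of h "\<lambda>x. \<phi> x * f x" n] \<open>h > 0\<close> int\<phi>f
      by (simp add: \<open>real n * h = T\<close> I_def)
    then have "\<bar>h * (\<Sum>k<n. \<phi> (real k * h) * f (\<xi> n k)) - integral {0..T} (\<lambda>x. \<phi> x * f x)\<bar> =
        \<bar>\<Sum>k<n. h * (\<phi> (real k * h) * f (\<xi> n k)) - integral (I k) (\<lambda>x. \<phi> x * f x)\<bar>"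
      by (simp only: sum_distrib_left sum_subtractf)
    also have "\<dots> \<le> (\<Sum>k<n. P * \<bar>h * f (\<xi> n k) - integral (I k) f\<bar> + e2 * M * h)"
      by (rule order_trans[OF sum_abs]) (intro sum_mono local, simp)
    also have "\<dots> = P * (\<Sum>k<n. \<bar>h * f (\<xi> n k) - integral (I k) f\<bar>) + e2 * M * T"
      using \<open>real n * h = T\<close> by (simp add: sum.distrib sum_distrib_left mult_ac)
    also have "\<dots> \<le> P * e1 + e2 * M * T"
      using Hen \<open>P \<ge> 0\<close> by (intro add_right_mono mult_left_mono)
    also have "\<dots> < e"
    proof -
      have "P * e1 \<le> e / 3" using \<open>P \<ge> 0\<close> \<open>e > 0\<close> by (simp add: e1_def field_simps)
      moreover have "e2 * M * T \<le> e / 3"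
      proof -
        have "e2 * M * T \<le> e2 * (M + 1) * T"
          using \<open>e2 > 0\<close> \<open>T > 0\<close> by (intro mult_right_mono mult_left_mono) auto
        also have "\<dots> = e / 3"
          using \<open>M \<ge> 0\<close> \<open>T > 0\<close> unfolding e2_def by (auto simp: divide_simps)
        finally show ?thesis .
      qed
      ultimately show ?thesis using \<open>e > 0\<close> by linarith
    qed
    finally show ?thesis by (simp add: dist_real_def h_def)
  qed
  then show "\<exists>N. \<forall>n\<ge>N. dist (T / real n * (\<Sum>k<n. \<phi> (real k * (T / real n)) * f (\<xi> n k)))
      (integral {0..T} (\<lambda>x. \<phi> x * f x)) < e" by blast
qed

section \<open>Absolutely continuous functions\<close>

lemma abs_continuous_onD:
  assumes "abs_continuous_on g a b" "\<epsilon> > 0"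
  obtains \<delta> where "\<delta> > 0"
    "\<And>d S. d division_of S \<Longrightarrow> S \<subseteq> {a..b} \<Longrightarrow> (\<Sum>K\<in>d. measure lborel K) < \<delta> \<Longrightarrow>
        (\<Sum>K\<in>d. norm (g (Sup K) - g (Inf K))) < \<epsilon>"
proof -
  from assms have "\<exists>\<delta>>0. \<forall>d S. d division_of S \<and> S \<subseteq> {a..b} \<and> (\<Sum>K\<in>d. measure lborel K) < \<delta> \<longrightarrow>
        (\<Sum>K\<in>d. norm (g (Sup K) - g (Inf K))) < \<epsilon>"
    unfolding abs_continuous_on_def by simp
  then obtain \<delta> where "\<delta> > 0" and \<delta>: "\<forall>d S. d division_of S \<and> S \<subseteq> {a..b} \<and> (\<Sum>K\<in>d. measure lborel K) < \<delta> \<longrightarrow>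
        (\<Sum>K\<in>d. norm (g (Sup K) - g (Inf K))) < \<epsilon>"
    by (elim exE conjE)
  show thesis by (rule that[OF \<open>\<delta> > 0\<close>]) (intro \<delta>[rule_format] conjI)
qed

text \<open>
  The fundamental theorem of calculus for absolutely continuous functions, in gauge form. At a point
  of differentiability the gauge is that of the classical proof. The exceptional points lie in an
  open set of small measure, and the intervals tagged there contribute little by absolute
  continuity.
\<close>

lemma has_integral_deriv_of_abs_continuous:
  fixes g g' :: "real \<Rightarrow> 'a::real_normed_vector"
  assumes "a \<le> b" and ac: "abs_continuous_on g a b"
    and deriv: "AE t in lebesgue. t \<in> {a..b} \<longrightarrow> (g has_vector_derivative g' t) (at t within {a..b})"
  shows "(g' has_integral g b - g a) {a..b}"
proof -
  from deriv obtain N where N: "negligible N"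
    and gder: "\<And>t. t \<in> {a..b} \<Longrightarrow> t \<notin> N \<Longrightarrow> (g has_vector_derivative g' t) (at t within {a..b})"
    unfolding eventually_ae_filter negligible_iff_null_sets by auto
  define G where "G t = (if t \<in> N then 0 else g' t)" for t
  have "(G has_integral g b - g a) (cbox a b)"
    unfolding has_integral
  proof safe
    fix e :: real assume "e > 0"
    obtain \<delta> where "\<delta> > 0" and \<delta>: "\<And>d S. d division_of S \<Longrightarrow> S \<subseteq> {a..b} \<Longrightarrow>
        (\<Sum>K\<in>d. measure lborel K) < \<delta> \<Longrightarrow> (\<Sum>K\<in>d. norm (g (Sup K) - g (Inf K))) < e / 2"
      using abs_continuous_onD[OF ac, of "e / 2"] \<open>e > 0\<close> by auto
    obtain U where U: "open U" "N \<subseteq> U" "U - N \<in> lmeasurable" "emeasure lebesgue (U - N) < ennreal \<delta>"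
      using sets_lebesgue_outer_open[OF _ \<open>\<delta> > 0\<close>, of N] N by (auto simp: negligible_iff_null_sets)
    have Nnull: "N \<in> null_sets lebesgue" using N by (simp add: negligible_iff_null_sets)
    have "U \<in> sets lebesgue" using U(1) by auto
    then have "emeasure lebesgue U = emeasure lebesgue (U - N)"
      using Nnull by (simp add: emeasure_Diff_null_set)
    with U(4) have emU: "emeasure lebesgue U < ennreal \<delta>" by simp
    then have Umeas: "U \<in> lmeasurable"
      using \<open>U \<in> sets lebesgue\<close> by (auto simp: fmeasurable_def intro: less_le_trans)
    have mU: "measure lebesgue U < \<delta>"
      using emU Umeas \<open>\<delta> > 0\<close> by (simp add: emeasure_eq_measure2 ennreal_less_iff)

    define \<eta> where "\<eta> = e / (2 * (b - a + 1))"
    have "\<eta> > 0" using \<open>e > 0\<close> \<open>a \<le> b\<close> by (simp add: \<eta>_def)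
    have "\<exists>d>0. \<forall>y\<in>{a..b}. norm (y - x) < d \<longrightarrow>
         norm (g y - g x - (y - x) *\<^sub>R g' x) \<le> \<eta> * norm (y - x)" if "x \<in> {a..b}" "x \<notin> N" for x
      using gder[OF that] \<open>\<eta> > 0\<close>
      unfolding has_vector_derivative_def has_derivative_within_alt by blast
    then obtain d where d: "\<And>x. x \<in> {a..b} \<Longrightarrow> x \<notin> N \<Longrightarrow> 0 < d x"
      "\<And>x y. x \<in> {a..b} \<Longrightarrow> x \<notin> N \<Longrightarrow> y \<in> {a..b} \<Longrightarrow> norm (y - x) < d x \<Longrightarrow>
         norm (g y - g x - (y - x) *\<^sub>R g' x) \<le> \<eta> * norm (y - x)"
      by metis
    define \<gamma> where "\<gamma> x = (if x \<in> N then U else if x \<in> {a..b} then ball x (d x) else UNIV)" for x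
    have "gauge \<gamma>"
      unfolding gauge_def \<gamma>_def using U d(1) by auto
    moreover have "norm ((\<Sum>(x, K)\<in>p. measure lborel K *\<^sub>R G x) - (g b - g a)) < e"
      if ptag: "p tagged_division_of cbox a b" and fine: "\<gamma> fine p" for p
    proof -
      have tag: "p tagged_division_of {a..b}" using ptag by simp
      have "finite p" using ptag by blast
      have ba: "b - a = (\<Sum>(x,K)\<in>p. Sup K - Inf K)" "g b - g a = (\<Sum>(x,K)\<in>p. g (Sup K) - g (Inf K))"
        using additive_tagged_division_1[OF \<open>a \<le> b\<close> tag, of "\<lambda>x. x"]
          additive_tagged_division_1[OF \<open>a \<le> b\<close> tag, of g] by auto
      \<comment> \<open>The intervals tagged at exceptional points.\<close>
      define q where "q = {xK \<in> p. fst xK \<in> N}"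
      have q: "q tagged_partial_division_of {a..b}"
        using tag unfolding q_def tagged_division_of_def
        by (auto intro: tagged_partial_division_subset)
      have single: "norm (measure lborel K *\<^sub>R G x - (g (Sup K) - g (Inf K))) \<le>
          \<eta> * (Sup K - Inf K) + (if x \<in> N then norm (g (Sup K) - g (Inf K)) else 0)" if "(x, K) \<in> p" for x K
      proof -
        obtain u v where K: "K = {u..v}" and "x \<in> K" and sub: "K \<subseteq> {a..b}"
          using tagged_division_ofD(2-4)[OF tag \<open>(x, K) \<in> p\<close>] by auto
        then have "u \<le> v" "u \<in> {a..b}" "v \<in> {a..b}" "x \<in> {a..b}" by auto
        show ?thesis
        proof (cases "x \<in> N")
          case True
          then show ?thesis using \<open>u \<le> v\<close> \<open>\<eta> > 0\<close> by (simp add: G_def K norm_minus_commute)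
        next
          case False
          have "K \<subseteq> ball x (d x)"
            using fineD[OF fine \<open>(x, K) \<in> p\<close>] False \<open>x \<in> {a..b}\<close> by (simp add: \<gamma>_def)
          then have "norm (u - x) < d x" "norm (v - x) < d x"
            using \<open>u \<le> v\<close> by (auto simp: K subset_eq dist_norm norm_minus_commute simp del: real_norm_def)
          have "norm ((v - u) *\<^sub>R g' x - (g v - g u)) =
              norm ((g u - g x - (u - x) *\<^sub>R g' x) - (g v - g x - (v - x) *\<^sub>R g' x))"
            by (simp add: algebra_simps)
          also have "\<dots> \<le> norm (g u - g x - (u - x) *\<^sub>R g' x) + norm (g v - g x - (v - x) *\<^sub>R g' x)"
            by (rule norm_triangle_ineq4)
          also have "\<dots> \<le> \<eta> * norm (u - x) + \<eta> * norm (v - x)"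
            using \<open>x \<in> {a..b}\<close> False \<open>u \<in> {a..b}\<close> \<open>v \<in> {a..b}\<close> \<open>norm (u - x) < d x\<close> \<open>norm (v - x) < d x\<close>
            by (intro add_mono d(2))
          also have "\<dots> = \<eta> * (v - u)"
            using \<open>x \<in> K\<close> by (auto simp: K algebra_simps)
          finally show ?thesis
            using False \<open>u \<le> v\<close> by (simp add: K G_def)
        qed
      qed
      have "(\<Sum>(x, K)\<in>p. if x \<in> N then norm (g (Sup K) - g (Inf K)) else 0)
          = (\<Sum>(x, K)\<in>q. norm (g (Sup K) - g (Inf K)))"
        unfolding q_def using \<open>finite p\<close>
        by (simp add: sum.inter_filter split_def)
      \<comment> \<open>\<open>Sup {}\<close> and \<open>Inf {}\<close> are unspecified reals, so the empty set is sent to \<open>0\<close> before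
        the passage from tagged intervals to intervals.\<close>
      also have "\<dots> = (\<Sum>(x, K)\<in>q. if K = {} then 0 else norm (g (Sup K) - g (Inf K)))"
        using q by (intro sum.cong) (auto dest: tagged_partial_division_ofD(2))
      also have "\<dots> = (\<Sum>K\<in>snd ` q. if K = {} then 0 else norm (g (Sup K) - g (Inf K)))"
        by (rule sum.over_tagged_division_lemma[OF tagged_partial_division_of_Union_self[OF q]])
           (auto simp: not_less le_less)
      also have "\<dots> = (\<Sum>K\<in>snd ` q. norm (g (Sup K) - g (Inf K)))"
        using q by (intro sum.cong) (auto dest: tagged_partial_division_ofD(2))
      also have "\<dots> < e / 2"
      proof (rule \<delta>)
        show div: "snd ` q division_of \<Union>(snd ` q)"
          by (rule partial_division_of_tagged_division[OF q])
        show "\<Union>(snd ` q) \<subseteq> {a..b}"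
          using tagged_partial_division_ofD(3)[OF q] by fastforce
        have "\<Union>(snd ` q) \<subseteq> U"
          using fineD[OF fine] by (fastforce simp: q_def \<gamma>_def split: if_splits)
        have "(\<Sum>K\<in>snd ` q. measure lborel K) = (\<Sum>K\<in>snd ` q. measure lebesgue K)"
        proof (rule sum.cong[OF refl])
          fix K assume "K \<in> snd ` q"
          then obtain u v where "K = cbox u v" using division_ofD(4)[OF div] by blast
          then have "K \<in> sets lborel" by simp
          then show "measure lborel K = measure lebesgue K" by (simp add: measure_completion)
        qed
        also have "\<dots> = measure lebesgue (\<Union>(snd ` q))"
          by (rule content_division[OF div])
        also have "\<dots> \<le> measure lebesgue U"
          using lmeasurable_division[OF div] Umeas \<open>\<Union>(snd ` q) \<subseteq> U\<close>
          by (intro measure_mono_fmeasurable) auto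
        also note mU
        finally show "(\<Sum>K\<in>snd ` q. measure lborel K) < \<delta>" .
      qed
      finally have bad: "(\<Sum>(x, K)\<in>p. if x \<in> N then norm (g (Sup K) - g (Inf K)) else 0) < e / 2" .
      have "norm ((\<Sum>(x, K)\<in>p. measure lborel K *\<^sub>R G x) - (g b - g a))
          = norm (\<Sum>(x, K)\<in>p. measure lborel K *\<^sub>R G x - (g (Sup K) - g (Inf K)))"
        by (simp add: ba(2) split_def sum_subtractf)
      also have "\<dots> \<le> (\<Sum>(x, K)\<in>p. \<eta> * (Sup K - Inf K) + (if x \<in> N then norm (g (Sup K) - g (Inf K)) else 0))"
        by (rule sum_norm_le) (use single in auto)
      also have "\<dots> = \<eta> * (b - a) + (\<Sum>(x, K)\<in>p. if x \<in> N then norm (g (Sup K) - g (Inf K)) else 0)"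
        by (simp add: ba(1) split_def sum.distrib sum_distrib_left)
      also have "\<eta> * (b - a) \<le> e / 2"
        using \<open>e > 0\<close> \<open>a \<le> b\<close> by (simp add: \<eta>_def field_simps)
      finally show ?thesis using bad by linarith
    qed
    ultimately show "\<exists>\<gamma>. gauge \<gamma> \<and> (\<forall>p. p tagged_division_of cbox a b \<and> \<gamma> fine p \<longrightarrow>
        norm ((\<Sum>(x, K)\<in>p. measure lborel K *\<^sub>R G x) - (g b - g a)) < e)"
      by (intro exI[of _ \<gamma>] conjI allI impI) auto
  qed
  then have "(G has_integral g b - g a) {a..b}" by simp
  then show ?thesis
    by (rule has_integral_spike[OF N, rotated]) (simp add: G_def)
qed

lemma abs_continuous_on_lipschitz:
  fixes g :: "real \<Rightarrow> 'a::real_normed_vector"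
  assumes lip: "\<And>u v. u \<in> {a..b} \<Longrightarrow> v \<in> {a..b} \<Longrightarrow> norm (g v - g u) \<le> L * \<bar>v - u\<bar>"
  shows "abs_continuous_on g a b"
  unfolding abs_continuous_on_def
proof (intro allI impI)
  fix e :: real assume "e > 0"
  have "(\<Sum>K\<in>d. norm (g (Sup K) - g (Inf K))) < e"
    if d: "d division_of S" "S \<subseteq> {a..b}" "(\<Sum>K\<in>d. measure lborel K) < e / (\<bar>L\<bar> + 1)" for d S
  proof -
    have "norm (g (Sup K) - g (Inf K)) \<le> (\<bar>L\<bar> + 1) * measure lborel K" if "K \<in> d" for K
    proof -
      have "K \<subseteq> {a..b}" "K \<noteq> {}" using division_ofD(2,3)[OF d(1) \<open>K \<in> d\<close>] d(2) by auto
      then obtain u v where K: "K = {u..v}" "K \<noteq> {}" "K \<subseteq> {a..b}"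
        using division_ofD(4)[OF d(1) \<open>K \<in> d\<close>] by (metis box_real(2))
      then have "u \<le> v" "u \<in> {a..b}" "v \<in> {a..b}" by auto
      then have "norm (g v - g u) \<le> L * (v - u)" using lip[of u v] by simp
      also have "\<dots> \<le> (\<bar>L\<bar> + 1) * (v - u)"
        using \<open>u \<le> v\<close> by (intro mult_right_mono) auto
      finally show ?thesis using \<open>u \<le> v\<close> by (simp add: K)
    qed
    then have "(\<Sum>K\<in>d. norm (g (Sup K) - g (Inf K))) \<le> (\<bar>L\<bar> + 1) * (\<Sum>K\<in>d. measure lborel K)"
      unfolding sum_distrib_left by (rule sum_mono)
    also have "\<dots> < (\<bar>L\<bar> + 1) * (e / (\<bar>L\<bar> + 1))"
      using d(3) by (intro mult_strict_left_mono) auto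
    finally show ?thesis by simp
  qed
  then show "\<exists>\<delta>>0. \<forall>d S. d division_of S \<and> S \<subseteq> {a..b} \<and> (\<Sum>K\<in>d. measure lborel K) < \<delta> \<longrightarrow>
        (\<Sum>K\<in>d. norm (g (Sup K) - g (Inf K))) < e"
    using \<open>e > 0\<close> by (intro exI[of _ "e / (\<bar>L\<bar> + 1)"]) auto
qed

lemma abs_continuous_on_mult_bounded:
  fixes f g :: "real \<Rightarrow> real"
  assumes acf: "abs_continuous_on f a b" and acg: "abs_continuous_on g a b"
    and bf: "\<And>x. x \<in> {a..b} \<Longrightarrow> \<bar>f x\<bar> \<le> A" and bg: "\<And>x. x \<in> {a..b} \<Longrightarrow> \<bar>g x\<bar> \<le> B"
  shows "abs_continuous_on (\<lambda>x. f x * g x) a b"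
  unfolding abs_continuous_on_def
proof (intro allI impI)
  fix e :: real assume "e > 0"
  let ?A = "\<bar>A\<bar> + 1" and ?B = "\<bar>B\<bar> + 1"
  obtain \<delta>1 where \<delta>1: "\<delta>1 > 0" "\<And>d S. d division_of S \<Longrightarrow> S \<subseteq> {a..b} \<Longrightarrow> (\<Sum>K\<in>d. measure lborel K) < \<delta>1 \<Longrightarrow>
        (\<Sum>K\<in>d. norm (f (Sup K) - f (Inf K))) < e / (2 * ?B)"
    by (rule abs_continuous_onD[OF acf, of "e / (2 * ?B)"]) (use \<open>e > 0\<close> in auto)
  obtain \<delta>2 where \<delta>2: "\<delta>2 > 0" "\<And>d S. d division_of S \<Longrightarrow> S \<subseteq> {a..b} \<Longrightarrow> (\<Sum>K\<in>d. measure lborel K) < \<delta>2 \<Longrightarrow>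
        (\<Sum>K\<in>d. norm (g (Sup K) - g (Inf K))) < e / (2 * ?A)"
    by (rule abs_continuous_onD[OF acg, of "e / (2 * ?A)"]) (use \<open>e > 0\<close> in auto)
  have "(\<Sum>K\<in>d. norm (f (Sup K) * g (Sup K) - f (Inf K) * g (Inf K))) < e"
    if d: "d division_of S" "S \<subseteq> {a..b}" "(\<Sum>K\<in>d. measure lborel K) < min \<delta>1 \<delta>2" for d S
  proof -
    have "norm (f (Sup K) * g (Sup K) - f (Inf K) * g (Inf K)) \<le>
        ?B * norm (f (Sup K) - f (Inf K)) + ?A * norm (g (Sup K) - g (Inf K))" if "K \<in> d" for K
    proof -
      have "K \<subseteq> {a..b}" "K \<noteq> {}" using division_ofD(2,3)[OF d(1) \<open>K \<in> d\<close>] d(2) by auto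
      then obtain u v where K: "K = {u..v}" "K \<noteq> {}" "K \<subseteq> {a..b}"
        using division_ofD(4)[OF d(1) \<open>K \<in> d\<close>] by (metis box_real(2))
      then have "u \<le> v" "u \<in> {a..b}" "v \<in> {a..b}" by auto
      have "norm (f v * g v - f u * g u) = \<bar>g v * (f v - f u) + f u * (g v - g u)\<bar>"
        by (simp add: algebra_simps)
      also have "\<dots> \<le> \<bar>g v\<bar> * \<bar>f v - f u\<bar> + \<bar>f u\<bar> * \<bar>g v - g u\<bar>"
        by (simp add: abs_mult[symmetric])
      also have "\<dots> \<le> ?B * \<bar>f v - f u\<bar> + ?A * \<bar>g v - g u\<bar>"
        using bg[OF \<open>v \<in> _\<close>] bf[OF \<open>u \<in> _\<close>] by (intro add_mono mult_right_mono) auto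
      finally show ?thesis using \<open>u \<le> v\<close> by (simp add: K)
    qed
    then have "(\<Sum>K\<in>d. norm (f (Sup K) * g (Sup K) - f (Inf K) * g (Inf K))) \<le>
        ?B * (\<Sum>K\<in>d. norm (f (Sup K) - f (Inf K))) + ?A * (\<Sum>K\<in>d. norm (g (Sup K) - g (Inf K)))"
      unfolding sum_distrib_left sum.distrib[symmetric] by (rule sum_mono)
    also have "\<dots> < ?B * (e / (2 * ?B)) + ?A * (e / (2 * ?A))"
      using \<delta>1(2)[OF d(1,2)] \<delta>2(2)[OF d(1,2)] d(3) by (intro add_strict_mono mult_strict_left_mono) auto
    also have "?B * (e / (2 * ?B)) = e / 2" by (simp add: field_simps)
    also have "?A * (e / (2 * ?A)) = e / 2" by (simp add: field_simps)
    finally show ?thesis by simp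
  qed
  then show "\<exists>\<delta>>0. \<forall>d S. d division_of S \<and> S \<subseteq> {a..b} \<and> (\<Sum>K\<in>d. measure lborel K) < \<delta> \<longrightarrow>
        (\<Sum>K\<in>d. norm (f (Sup K) * g (Sup K) - f (Inf K) * g (Inf K))) < e"
    using \<delta>1(1) \<delta>2(1) by (intro exI[of _ "min \<delta>1 \<delta>2"]) auto
qed

lemma abs_continuous_on_inner_left:
  fixes c :: "real \<Rightarrow> 'a::real_inner"
  assumes "abs_continuous_on c a b"
  shows "abs_continuous_on (\<lambda>t. w \<bullet> c t) a b"
  unfolding abs_continuous_on_def
proof (intro allI impI)
  fix e :: real assume "e > 0"
  let ?W = "norm w + 1"
  have "?W > 0" by (simp add: add_nonneg_pos)
  obtain \<delta> where \<delta>: "\<delta> > 0" "\<And>d S. d division_of S \<Longrightarrow> S \<subseteq> {a..b} \<Longrightarrow> (\<Sum>K\<in>d. measure lborel K) < \<delta> \<Longrightarrow>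
        (\<Sum>K\<in>d. norm (c (Sup K) - c (Inf K))) < e / ?W"
    by (rule abs_continuous_onD[OF assms, of "e / ?W"]) (use \<open>e > 0\<close> \<open>?W > 0\<close> in auto)
  have "(\<Sum>K\<in>d. norm (w \<bullet> c (Sup K) - w \<bullet> c (Inf K))) < e"
    if d: "d division_of S" "S \<subseteq> {a..b}" "(\<Sum>K\<in>d. measure lborel K) < \<delta>" for d S
  proof -
    have "norm (w \<bullet> c (Sup K) - w \<bullet> c (Inf K)) \<le> ?W * norm (c (Sup K) - c (Inf K))" for K
    proof -
      have "norm (w \<bullet> c (Sup K) - w \<bullet> c (Inf K)) \<le> norm w * norm (c (Sup K) - c (Inf K))"
        using Cauchy_Schwarz_ineq2[of w "c (Sup K) - c (Inf K)"] by (simp add: inner_diff_right)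
      also have "\<dots> \<le> ?W * norm (c (Sup K) - c (Inf K))" by (intro mult_right_mono) auto
      finally show ?thesis .
    qed
    then have "(\<Sum>K\<in>d. norm (w \<bullet> c (Sup K) - w \<bullet> c (Inf K))) \<le> ?W * (\<Sum>K\<in>d. norm (c (Sup K) - c (Inf K)))"
      unfolding sum_distrib_left by (rule sum_mono)
    also have "\<dots> < ?W * (e / ?W)"
      using \<delta>(2)[OF d] \<open>?W > 0\<close> by (rule mult_strict_left_mono)
    finally show ?thesis using \<open>?W > 0\<close> by simp
  qed
  then show "\<exists>\<delta>>0. \<forall>d S. d division_of S \<and> S \<subseteq> {a..b} \<and> (\<Sum>K\<in>d. measure lborel K) < \<delta> \<longrightarrow>
        (\<Sum>K\<in>d. norm (w \<bullet> c (Sup K) - w \<bullet> c (Inf K))) < e"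
    using \<delta>(1) by blast
qed

lemma abs_continuous_on_power: "abs_continuous_on (\<lambda>t. t ^ l) a b"
proof (induction l)
  case 0
  show ?case by (rule abs_continuous_on_lipschitz[where L = 0]) simp
next
  case (Suc l)
  have id: "abs_continuous_on (\<lambda>t. t) a b"
    by (rule abs_continuous_on_lipschitz[where L = 1]) simp
  let ?A = "max \<bar>a\<bar> \<bar>b\<bar>"
  have A: "\<bar>t\<bar> \<le> ?A" if "t \<in> {a..b}" for t using that by auto
  have "\<bar>t ^ l\<bar> \<le> ?A ^ l" if "t \<in> {a..b}" for t
    unfolding power_abs using A[OF that] by (intro power_mono) auto
  from abs_continuous_on_mult_bounded[OF id Suc.IH A this]
  show ?case by simp
qed

section \<open>Left eigenvectors\<close>

lemma inner_matrix_left_eigen: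
  fixes A :: "real^'n^'n"
  assumes "w v* A = l *\<^sub>R w"
  shows "w \<bullet> (A *v x) = l * (w \<bullet> x)"
proof -
  have "w \<bullet> (A *v x) = (l *\<^sub>R w) \<bullet> x" by (simp only: dot_lmul_matrix[symmetric] assms)
  then show ?thesis by simp
qed

lemma left_eigen_affine:
  fixes A :: "real^'n^'n"
  assumes "w v* A = l *\<^sub>R w"
  shows "w v* (mat 1 + a *\<^sub>R A) = (1 + a * l) *\<^sub>R w" and "w v* (mat 1 - a *\<^sub>R A) = (1 - a * l) *\<^sub>R w"
proof -
  have "w v* (a *\<^sub>R A) = (a * l) *\<^sub>R w"
    using vector_scaleR_matrix_ac[where k = a and x = w and A = A] assms by simp
  then show "w v* (mat 1 + a *\<^sub>R A) = (1 + a * l) *\<^sub>R w" "w v* (mat 1 - a *\<^sub>R A) = (1 - a * l) *\<^sub>R w"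
    by (simp_all add: vector_matrix_mult_add_rdistrib vector_matrix_mult_diff_rdistrib scaleR_left_distrib
        scaleR_left_diff_distrib)
qed

lemma left_eigen_matrix_inv:
  fixes M :: "real^'n^'n"
  assumes "invertible M" and "w v* M = m *\<^sub>R w" and "m \<noteq> 0"
  shows "w v* matrix_inv M = (1 / m) *\<^sub>R w"
proof -
  have "\<exists>B. M ** B = mat 1 \<and> B ** M = mat 1" using assms(1) by (simp add: invertible_def)
  then have "M ** matrix_inv M = mat 1"
    unfolding matrix_inv_def by (rule someI2_ex) simp
  then have "(w v* M) v* matrix_inv M = w"
    by (simp add: vector_matrix_mul_assoc)
  then have "m *\<^sub>R (w v* matrix_inv M) = w"
    by (simp add: assms(2) scaleR_vector_matrix_assoc)
  then have "(1 / m) *\<^sub>R (m *\<^sub>R (w v* matrix_inv M)) = (1 / m) *\<^sub>R w" by simp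
  then show ?thesis using assms(3) by simp
qed

lemma mat_exp_summable:
  fixes M :: "real^'n^'n"
  shows "summable (\<lambda>k. (1 / fact k) *\<^sub>R (((**) M ^^ k) (mat 1)))"
proof -
  have "linear ((**) M :: real^'n^'n \<Rightarrow> real^'n^'n)"
    by (rule linearI) (simp_all add: matrix_add_ldistrib matrix_scalar_ac scalar_matrix_assoc)
  then have "bounded_linear ((**) M :: real^'n^'n \<Rightarrow> real^'n^'n)"
    by (simp add: linear_conv_bounded_linear)
  then obtain C where "C > 0" and C: "\<And>X :: real^'n^'n. norm (M ** X) \<le> norm X * C"
    using bounded_linear.pos_bounded by blast
  have pow: "norm (((**) M ^^ k) (mat 1)) \<le> C ^ k * norm (mat 1 :: real^'n^'n)" for k
  proof (induction k)
    case (Suc k)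
    have "norm (((**) M ^^ Suc k) (mat 1)) \<le> norm (((**) M ^^ k) (mat 1)) * C"
      using C[of "((**) M ^^ k) (mat 1)"] by simp
    also have "\<dots> \<le> C ^ k * norm (mat 1 :: real^'n^'n) * C"
      using Suc.IH \<open>C > 0\<close> by (intro mult_right_mono) auto
    finally show ?case by (simp add: mult_ac)
  qed simp
  have "summable (\<lambda>k. inverse (fact k) * C ^ k * norm (mat 1 :: real^'n^'n))"
    by (intro summable_mult2 summable_exp)
  then show ?thesis
  proof (rule summable_comparison_test'[where N = 0])
    fix k :: nat
    show "norm ((1 / fact k) *\<^sub>R (((**) M ^^ k) (mat 1))) \<le> inverse (fact k) * C ^ k * norm (mat 1 :: real^'n^'n)"
      using mult_left_mono[OF pow[of k], of "inverse (fact k)"] by (simp add: divide_inverse mult.assoc)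
  qed
qed

lemma left_eigen_mat_exp:
  fixes M :: "real^'n^'n"
  assumes "w v* M = m *\<^sub>R w"
  shows "w v* mat_exp M = exp m *\<^sub>R w"
proof -
  have pow: "w v* (((**) M ^^ k) (mat 1)) = m ^ k *\<^sub>R w" for k
  proof (induction k)
    case (Suc k)
    have "w v* (((**) M ^^ Suc k) (mat 1)) = (w v* M) v* (((**) M ^^ k) (mat 1))"
      by (simp add: vector_matrix_mul_assoc)
    also have "\<dots> = m *\<^sub>R (w v* (((**) M ^^ k) (mat 1)))"
      unfolding assms by (simp add: scaleR_vector_matrix_assoc)
    finally show ?case using Suc.IH by simp
  qed simp
  have "linear (\<lambda>X :: real^'n^'n. w v* X)"
    by (rule linearI)
       (simp_all add: vector_matrix_mult_def vec_eq_iff distrib_left sum.distrib sum_distrib_left mult_ac)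
  then have "bounded_linear (\<lambda>X :: real^'n^'n. w v* X)"
    by (simp add: linear_conv_bounded_linear)
  from bounded_linear.sums[OF this summable_sums[OF mat_exp_summable[of M]]]
  have "(\<lambda>k. w v* ((1 / fact k) *\<^sub>R (((**) M ^^ k) (mat 1)))) sums (w v* mat_exp M)"
    by (simp add: mat_exp_def)
  moreover have "w v* ((1 / fact k) *\<^sub>R (((**) M ^^ k) (mat 1))) = (m ^ k /\<^sub>R fact k) *\<^sub>R w" for k
    by (simp add: vector_scaleR_matrix_ac pow divide_inverse)
  moreover have "(\<lambda>k. (m ^ k /\<^sub>R fact k) *\<^sub>R w) sums (exp m *\<^sub>R w)"
    by (rule bounded_linear.sums[OF bounded_linear_scaleR_left exp_converges])
  ultimately show ?thesis by (simp only: sums_unique2)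
qed

lemma invertible_lower_triangular:
  fixes A :: "real^'n::{finite,wellorder}^'n::{finite,wellorder}"
  assumes "\<And>i j. i < j \<Longrightarrow> A $ i $ j = 0" and "\<And>i. A $ i $ i \<noteq> 0"
  shows "invertible A"
  using det_lowerdiagonal[of A] assms by (simp add: invertible_det_nz)

lemma lower_triangular_left_eigenvector:
  fixes A :: "real^'n::{finite,wellorder}^'n::{finite,wellorder}"
  assumes tri: "\<And>i j. i < j \<Longrightarrow> A $ i $ j = 0"
  obtains w where "w \<noteq> 0" "w v* A = (A $ i $ i) *\<^sub>R w"
proof -
  let ?M = "A - (A $ i $ i) *\<^sub>R mat 1"
  have "det ?M = (\<Prod>j\<in>UNIV. ?M $ j $ j)"
    by (rule det_lowerdiagonal) (use tri in \<open>auto simp: mat_def\<close>)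
  also have "\<dots> = 0" by (rule prod_zero) (auto simp: mat_def intro: exI[of _ i])
  finally have "det (transpose ?M) = 0" by (simp add: det_transpose)
  then have "\<not> invertible (transpose ?M)" using invertible_det_nz by blast
  then have "\<not> (\<exists>B. B ** transpose ?M = mat 1)" using invertible_left_inverse by blast
  then obtain w where "transpose ?M *v w = 0" "w \<noteq> 0"
    using matrix_left_invertible_ker by blast
  then have "w v* ?M = 0" by simp
  then have "w v* A - (A $ i $ i) *\<^sub>R (w v* mat 1) = 0"
    by (simp only: vector_matrix_mult_diff_rdistrib vector_scaleR_matrix_ac)
  then show thesis using \<open>w \<noteq> 0\<close> by (intro that[of w]) auto
qed

text \<open>
  Eigenvectors for distinct eigenvalues are independent, and there are as many of them as the
  dimension.
\<close>

lemma eigenvectors_span_UNIV: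
  fixes A :: "real^'n^'n" and g :: "'n \<Rightarrow> real^'n"
  assumes "inj e" and nz: "\<And>i. g i \<noteq> 0" and eig: "\<And>i. g i v* A = e i *\<^sub>R g i"
  shows "span (range g) = UNIV"
proof -
  have lin: "linear (\<lambda>w. w v* A)"
    by (rule linearI)
       (simp_all add: vector_matrix_mult_def vec_eq_iff distrib_left sum.distrib sum_distrib_left mult_ac)
  have indep: "\<forall>i\<in>S. a i = 0" if "finite S" "(\<Sum>i\<in>S. a i *\<^sub>R g i) = 0" for S and a :: "'n \<Rightarrow> real"
    using that
  proof (induction S arbitrary: a rule: finite_induct)
    case (insert s S)
    have "(\<Sum>i\<in>insert s S. (a i * e i) *\<^sub>R g i) = (\<Sum>i\<in>insert s S. a i *\<^sub>R g i) v* A"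
      by (simp add: linear_sum[OF lin] linear_cmul[OF lin] eig)
    also have "\<dots> = 0" using insert.prems linear_0[OF lin] by simp
    finally have "(\<Sum>i\<in>insert s S. (a i * e i) *\<^sub>R g i) - e s *\<^sub>R (\<Sum>i\<in>insert s S. a i *\<^sub>R g i) = 0"
      using insert.prems by simp
    then have "(\<Sum>i\<in>S. (a i * (e i - e s)) *\<^sub>R g i) = 0"
      using insert.hyps
      by (simp add: scaleR_right.sum sum_subtractf algebra_simps)
    then have "\<forall>i\<in>S. a i * (e i - e s) = 0" by (rule insert.IH)
    then have S0: "\<forall>i\<in>S. a i = 0" using insert.hyps(2) injD[OF \<open>inj e\<close>] by auto
    then have "a s *\<^sub>R g s = 0" using insert.prems insert.hyps by simp
    with S0 nz show ?case by simp
  qed simp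
  have "inj g"
  proof (rule injI)
    fix i j assume "g i = g j"
    then have "e i *\<^sub>R g i = e j *\<^sub>R g i" using eig[of i] eig[of j] by metis
    then have "e i = e j" using nz[of i] by simp
    then show "i = j" using injD[OF \<open>inj e\<close>] by blast
  qed
  have "independent (range g)"
  proof (rule independent_if_scalars_zero)
    fix u x assume u: "(\<Sum>x\<in>range g. u x *\<^sub>R x) = 0" and "x \<in> range g"
    then have "(\<Sum>i\<in>UNIV. u (g i) *\<^sub>R g i) = 0"
      by (simp add: sum.reindex[OF \<open>inj g\<close>])
    then have "\<forall>i\<in>UNIV. u (g i) = 0" by (rule indep[OF finite])
    then show "u x = 0" using \<open>x \<in> range g\<close> by blast
  qed simp
  moreover have "card (range g) = DIM(real^'n)"
    by (simp add: card_image[OF \<open>inj g\<close>])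
  ultimately have "UNIV \<subseteq> span (range g)"
    by (intro card_ge_dim_independent) auto
  then show ?thesis by auto
qed

lemma tendsto_0_if_inner_spanning:
  fixes x :: "nat \<Rightarrow> 'a::euclidean_space"
  assumes "span S = UNIV" and "\<And>w. w \<in> S \<Longrightarrow> (\<lambda>n. w \<bullet> x n) \<longlonglongrightarrow> 0"
  shows "(\<lambda>n. norm (x n)) \<longlonglongrightarrow> 0"
proof -
  have "(\<lambda>n. w \<bullet> x n) \<longlonglongrightarrow> 0" for w
  proof -
    have "w \<in> span S" using assms(1) by simp
    then show ?thesis
    proof (induction rule: span_induct_alt)
      case (step c a y)
      have "(\<lambda>n. c * (a \<bullet> x n) + y \<bullet> x n) \<longlonglongrightarrow> c * 0 + 0"
        by (intro tendsto_intros assms(2) step)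
      then show ?case by (simp add: inner_add_left)
    qed simp
  qed
  then have "(\<lambda>n. \<Sum>b\<in>Basis. \<bar>b \<bullet> x n\<bar>) \<longlonglongrightarrow> (\<Sum>b\<in>(Basis::'a set). \<bar>0\<bar>)"
    by (intro tendsto_intros)
  then have lim: "(\<lambda>n. \<Sum>b\<in>Basis. \<bar>b \<bullet> x n\<bar>) \<longlonglongrightarrow> 0" by simp
  have "norm (norm (x n)) \<le> (\<Sum>b\<in>Basis. \<bar>b \<bullet> x n\<bar>)" for n
    using norm_le_l1[of "x n"] unfolding inner_commute[of "x n"] by simp
  then show ?thesis
    by (intro Lim_null_comparison[OF _ lim] always_eventually allI)
qed

section \<open>Left eigenvectors of the LegS matrices\<close>

lemma pos_less_iff: "pos i < pos j \<longleftrightarrow> i < (j :: 'n::{finite,wellorder})"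
proof -
  have mono: "pos i < pos j" if "i < j" for i j :: 'n
    unfolding pos_def using that by (intro psubset_card_mono) auto
  show ?thesis by (metis mono not_less_iff_gr_or_eq)
qed

lemma pos_ge_1: "pos i \<ge> 1"
  unfolding pos_def by (simp add: Suc_le_eq card_gt_0_iff)

lemma legs_A_upper: "i < j \<Longrightarrow> legs_A $ i $ j = 0"
  using pos_less_iff[of i j] by (simp add: legs_A_def)

lemma legs_A_diag: "legs_A $ i $ i = real (pos i)"
  by (simp add: legs_A_def)

lemma invertible_legs_A: "invertible legs_A"
  by (rule invertible_lower_triangular) (use pos_ge_1 in \<open>auto simp: legs_A_upper legs_A_diag Suc_le_eq\<close>)

lemma invertible_one_plus_legs_A:
  assumes "a \<ge> 0"
  shows "invertible (mat 1 + a *\<^sub>R legs_A)"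
  by (rule invertible_lower_triangular)
     (use assms in \<open>auto simp: legs_A_upper legs_A_diag mat_def add_nonneg_eq_0_iff\<close>)

lemma inner_implicit_solve:
  fixes w :: "real ^ 'n::{finite,wellorder}"
  assumes "w v* legs_A = real l *\<^sub>R w" and "a \<ge> 0"
  shows "w \<bullet> (matrix_inv (mat 1 + a *\<^sub>R legs_A) *v x) = (w \<bullet> x) / (1 + a * real l)"
proof -
  have "1 + a * real l > 0" using assms(2) by (simp add: add_pos_nonneg)
  then have "w v* matrix_inv (mat 1 + a *\<^sub>R legs_A) = (1 / (1 + a * real l)) *\<^sub>R w"
    by (intro left_eigen_matrix_inv invertible_one_plus_legs_A left_eigen_affine assms) simp
  from inner_matrix_left_eigen[OF this] show ?thesis by simp
qed

lemma inner_explicit_step: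
  fixes w :: "real ^ 'n::{finite,wellorder}"
  assumes "w v* legs_A = real l *\<^sub>R w"
  shows "w \<bullet> ((mat 1 - a *\<^sub>R legs_A) *v x) = (1 - a * real l) * (w \<bullet> x)"
  by (rule inner_matrix_left_eigen) (rule left_eigen_affine(2)[OF assms])

text \<open>
  At \<open>k = 0\<close> both sides vanish: the matrix is zero by convention, and \<open>l \<ge> 1\<close>.
\<close>

lemma inner_zoh_matrix:
  fixes w :: "real ^ 'n::{finite,wellorder}"
  assumes "w v* legs_A = real l *\<^sub>R w" and "l \<ge> 1"
  shows "w \<bullet> (zoh_matrix k *v x) = (real k / real (Suc k)) ^ l * (w \<bullet> x)"
proof (cases "k = 0")
  case True
  then show ?thesis using assms(2) by (simp add: zoh_matrix_def power_0_left)
next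
  case False
  let ?s = "ln (real k / real (k + 1))"
  have "w v* (?s *\<^sub>R legs_A) = (?s * real l) *\<^sub>R w"
    by (simp add: vector_scaleR_matrix_ac assms(1))
  from inner_matrix_left_eigen[OF left_eigen_mat_exp[OF this]]
  have "w \<bullet> (zoh_matrix k *v x) = exp (?s * real l) * (w \<bullet> x)"
    using False by (simp add: zoh_matrix_def)
  also have "exp (?s * real l) = exp ?s ^ l"
    by (simp add: exp_of_nat2_mult)
  also have "exp ?s = real k / real (Suc k)" using False by simp
  finally show ?thesis .
qed

lemma inner_legs_A_inverse:
  fixes w :: "real ^ 'n::{finite,wellorder}"
  assumes "w v* legs_A = real l *\<^sub>R w" and "l \<ge> 1"
  shows "w \<bullet> (matrix_inv legs_A *v x) = (w \<bullet> x) / real l"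
proof -
  have "w v* matrix_inv legs_A = (1 / real l) *\<^sub>R w"
    by (rule left_eigen_matrix_inv[OF invertible_legs_A assms(1)]) (use assms(2) in simp)
  from inner_matrix_left_eigen[OF this] show ?thesis by simp
qed

section \<open>Convergence of the discretizations\<close>

text \<open>
  Along a left eigenvector the equation reads \<open>(t\<^sup>l y)' = b t\<^bsup>l-1\<^esup> f\<close>. The function \<open>t\<^sup>l y\<close> vanishes at
  \<open>0\<close> because \<open>y\<close> is continuous there, so the solution is determined without the prescribed initial
  value. The equation is integrated over \<open>{\<epsilon>..T}\<close> and \<open>\<epsilon>\<close> tends to \<open>0\<close>.
\<close>

lemma legs_solution_left_eigen:
  fixes c :: "real \<Rightarrow> real ^ 'n::{finite,wellorder}"
  assumes "T > 0" and riem: "riemann_integrable_on f 0 T" and sol: "legs_solution T f c"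
    and "l \<ge> 1" and eig: "w v* legs_A = real l *\<^sub>R w"
  shows "w \<bullet> c T = (w \<bullet> legs_B) / T ^ l * integral {0..T} (\<lambda>s. s ^ (l - 1) * f s)"
proof -
  have cont: "continuous_on {0..T} c"
    and ac: "\<And>\<epsilon>. 0 < \<epsilon> \<Longrightarrow> \<epsilon> < T \<Longrightarrow> abs_continuous_on c \<epsilon> T"
    and ode: "AE t in lebesgue. t \<in> {0<..T} \<longrightarrow>
        (c has_vector_derivative
           (- (1 / t)) *\<^sub>R (legs_A *v c t) + ((1 / t) * f t) *\<^sub>R legs_B) (at t within {0..T})"
    using sol unfolding legs_solution_def by auto
  define b where "b = w \<bullet> legs_B"
  define y where "y t = w \<bullet> c t" for t
  define z where "z t = t ^ l * y t" for t
  let ?g = "\<lambda>s. s ^ (l - 1) * f s"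
  have g_int: "?g integrable_on {0..T}"
    by (rule continuous_mult_riemann_integrable[OF \<open>T > 0\<close> riem]) (intro continuous_intros)
  have ycont: "continuous_on {0..T} y"
    unfolding y_def by (intro continuous_intros cont)
  have zcont: "continuous_on {0..T} z"
    unfolding z_def by (intro continuous_intros ycont)
  have "bounded (y ` {0..T})"
    by (intro compact_imp_bounded compact_continuous_image ycont) simp
  then obtain Y where Y: "\<forall>t\<in>{0..T}. \<bar>y t\<bar> \<le> Y" by (auto simp: bounded_iff)
  have zderiv: "(z has_vector_derivative b * ?g t) (at t within {\<epsilon>..T})"
    if "0 < \<epsilon>" "t \<in> {\<epsilon>..T}" and ct: "(c has_vector_derivative
           (- (1 / t)) *\<^sub>R (legs_A *v c t) + ((1 / t) * f t) *\<^sub>R legs_B) (at t within {0..T})" for t \<epsilon>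
  proof -
    have "t > 0" using that by simp
    have "(c has_vector_derivative
           (- (1 / t)) *\<^sub>R (legs_A *v c t) + ((1 / t) * f t) *\<^sub>R legs_B) (at t within {\<epsilon>..T})"
      by (rule has_vector_derivative_within_subset[OF ct]) (use that in auto)
    from bounded_linear.has_vector_derivative[OF bounded_linear_inner_right this, of w]
    have "(y has_vector_derivative - (1 / t) * (real l * y t) + (1 / t) * f t * b) (at t within {\<epsilon>..T})"
      by (simp add: y_def[abs_def] b_def inner_add_right inner_diff_right inner_matrix_left_eigen[OF eig])
    then have "(y has_real_derivative - (1 / t) * (real l * y t) + (1 / t) * f t * b) (at t within {\<epsilon>..T})"
      by (simp add: has_real_derivative_iff_has_vector_derivative)
    moreover have "((\<lambda>t. t ^ l) has_real_derivative real l * t ^ (l - 1)) (at t within {\<epsilon>..T})"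
      by (auto intro!: derivative_eq_intros)
    ultimately
    have "(z has_real_derivative
        real l * t ^ (l - 1) * y t + (- (1 / t) * (real l * y t) + (1 / t) * f t * b) * t ^ l) (at t within {\<epsilon>..T})"
      unfolding z_def[abs_def] by (intro DERIV_mult)
    moreover have "real l * t ^ (l - 1) * y t + (- (1 / t) * (real l * y t) + (1 / t) * f t * b) * t ^ l = b * ?g t"
      using \<open>t > 0\<close> \<open>l \<ge> 1\<close> by (cases l) (auto simp: field_simps)
    ultimately show ?thesis
      by (simp add: has_real_derivative_iff_has_vector_derivative)
  qed
  have z_eq: "z T - b * integral {0..T} ?g = z \<epsilon> - b * integral {0..\<epsilon>} ?g" if \<epsilon>: "0 < \<epsilon>" "\<epsilon> < T" for \<epsilon>
  proof -
    have "abs_continuous_on z \<epsilon> T"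
      unfolding z_def[abs_def]
    proof (rule abs_continuous_on_mult_bounded[OF abs_continuous_on_power])
      show "abs_continuous_on y \<epsilon> T"
        unfolding y_def by (rule abs_continuous_on_inner_left[OF ac[OF \<epsilon>]])
      show "\<bar>t ^ l\<bar> \<le> T ^ l" if "t \<in> {\<epsilon>..T}" for t
        unfolding power_abs using that \<epsilon> by (intro power_mono) auto
      show "\<bar>y t\<bar> \<le> Y" if "t \<in> {\<epsilon>..T}" for t using Y that \<epsilon> by auto
    qed
    moreover have "AE t in lebesgue. t \<in> {\<epsilon>..T} \<longrightarrow> (z has_vector_derivative b * ?g t) (at t within {\<epsilon>..T})"
      using ode by (rule AE_mp) (use \<epsilon> zderiv in \<open>auto intro!: AE_I2\<close>)
    ultimately have "((\<lambda>t. b * ?g t) has_integral z T - z \<epsilon>) {\<epsilon>..T}"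
      using has_integral_deriv_of_abs_continuous[of \<epsilon> T z] \<epsilon> by simp
    then have "z T - z \<epsilon> = b * integral {\<epsilon>..T} ?g"
      by (metis integral_mult_right integral_unique)
    moreover have "integral {0..\<epsilon>} ?g + integral {\<epsilon>..T} ?g = integral {0..T} ?g"
      using \<epsilon> by (intro Henstock_Kurzweil_Integration.integral_combine g_int) auto
    ultimately show ?thesis by (simp add: algebra_simps flip: distrib_left)
  qed
  \<comment> \<open>Constant on \<open>{0<..T}\<close> and continuous on \<open>{0..T}\<close>, hence equal to its value at \<open>0\<close>.\<close>
  let ?G = "\<lambda>t. z t - b * integral {0..t} ?g"
  have Gcont: "continuous_on {0..T} ?G"
    by (intro continuous_intros zcont indefinite_integral_continuous_1 g_int)
  have "(\<lambda>n. T / real (n + 2)) \<longlonglongrightarrow> 0" by real_asymp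
  then have "(\<lambda>n. ?G (T / real (n + 2))) \<longlonglongrightarrow> ?G 0"
    by (rule continuous_on_tendsto_compose[OF Gcont])
       (use \<open>T > 0\<close> in \<open>auto intro!: always_eventually simp: divide_simps\<close>)
  moreover have "?G (T / real (n + 2)) = ?G T" for n
    using z_eq[of "T / real (n + 2)"] \<open>T > 0\<close> by (simp add: divide_simps)
  ultimately have "?G T = ?G 0"
    by (simp only: LIMSEQ_const_iff)
  also have "\<dots> = 0" using \<open>l \<ge> 1\<close> by (simp add: z_def)
  finally have "T ^ l * y T = b * integral {0..T} ?g" by (simp add: z_def)
  then show ?thesis using \<open>T > 0\<close> unfolding y_def b_def by (simp add: field_simps)
qed

text \<open>
  The coefficients of a scalar one-step method
  \<open>y\<^bsub>k+1\<^esub> = \<rho> k * y\<^sub>k + b * (p k * f\<^sub>k + q k * f\<^bsub>k+1\<^esub>)\<close> for \<open>y' = (- l y + b f) / t\<close> agree with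
  \<open>1 - l / k\<close>, \<open>\<theta> / k\<close> and \<open>(1 - \<theta>) / k\<close> up to \<open>O(1 / k\<^sup>2)\<close>. The parameter \<open>\<theta>\<close> is the share of the
  left endpoint in the sampling of \<open>f\<close>. The condition is asymptotic, so the first step is
  unrestricted.
\<close>

definition consistent_coeffs ::
  "nat \<Rightarrow> real \<Rightarrow> (nat \<Rightarrow> real) \<Rightarrow> (nat \<Rightarrow> real) \<Rightarrow> (nat \<Rightarrow> real) \<Rightarrow> bool" where
  "consistent_coeffs l \<theta> \<rho> p q \<longleftrightarrow>
     (\<lambda>k. \<rho> k - 1 + real l / real k) \<in> O(\<lambda>k. 1 / (real k)\<^sup>2) \<and>
     (\<lambda>k. p k - \<theta> / real k) \<in> O(\<lambda>k. 1 / (real k)\<^sup>2) \<and>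
     (\<lambda>k. q k - (1 - \<theta>) / real k) \<in> O(\<lambda>k. 1 / (real k)\<^sup>2)"

lemma scalar_one_step_scheme_tendsto:
  fixes y :: "real \<Rightarrow> nat \<Rightarrow> real"
  assumes "T > 0" and riem: "riemann_integrable_on f 0 T" and "l \<ge> 1"
    and coeffs: "consistent_coeffs l \<theta> \<rho> p q"
    and y0: "\<And>h. y h 0 = v"
    and y: "\<And>h k. y h (Suc k) = \<rho> k * y h k + b * (p k * f (real k * h) + q k * f (real (Suc k) * h))"
  shows "(\<lambda>n. y (T / real n) n) \<longlonglongrightarrow> b / T ^ l * integral {0..T} (\<lambda>s. s ^ (l - 1) * f s)"
proof -
  obtain M where M: "\<And>x. x \<in> {0..T} \<Longrightarrow> \<bar>f x\<bar> \<le> M"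
    using riemann_integrable_on_imp_bounded[OF \<open>T > 0\<close> riem] by blast
  define F where "F n k = f (real k * (T / real n))" for n k
  have F: "\<bar>F n k\<bar> \<le> M" if "k \<le> n" for n k
  proof -
    have "real k * (T / real n) \<le> T"
      using that \<open>T > 0\<close> by (cases "n = 0") (auto simp: divide_simps)
    then show ?thesis unfolding F_def using \<open>T > 0\<close> by (intro M) auto
  qed
  let ?S = "\<lambda>n. b / real n ^ l * (\<Sum>k<n. real k ^ (l - 1) * (\<theta> * F n k + (1 - \<theta>) * F n (Suc k)))"
  note coeffs' = coeffs[unfolded consistent_coeffs_def, THEN conjunct1]
    coeffs[unfolded consistent_coeffs_def, THEN conjunct2, THEN conjunct1]
    coeffs[unfolded consistent_coeffs_def, THEN conjunct2, THEN conjunct2]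
  have step: "y (T / real n) (Suc k) = \<rho> k * y (T / real n) k + b * (p k * F n k + q k * F n (Suc k))" for n k
    unfolding F_def by (rule y)
  have diff: "(\<lambda>n. y (T / real n) n - ?S n) \<longlonglongrightarrow> 0"
    by (rule one_step_scheme_approx_riemann_sum[where y = "\<lambda>n. y (T / real n)", OF \<open>l \<ge> 1\<close> coeffs' F y0 step])
  let ?I = "integral {0..T} (\<lambda>s. s ^ (l - 1) * f s)"
  let ?R = "\<lambda>i n. T / real n * (\<Sum>k<n. (real k * (T / real n)) ^ (l - 1) * F n (k + i))"
  have R: "?R i \<longlonglongrightarrow> ?I" if "i \<le> 1" for i
    unfolding F_def
  proof (rule weighted_riemann_sums_tendsto[OF \<open>T > 0\<close> riem, where \<phi> = "\<lambda>s. s ^ (l - 1)"])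
    show "real (k + i) * (T / real n) \<in> {real k * (T / real n)..real (Suc k) * (T / real n)}" for n k
      unfolding atLeastAtMost_iff using that \<open>T > 0\<close> by (intro conjI mult_right_mono) auto
  qed (intro continuous_intros)
  have "(\<lambda>n. b / T ^ l * (\<theta> * ?R 0 n + (1 - \<theta>) * ?R 1 n)) \<longlonglongrightarrow> b / T ^ l * (\<theta> * ?I + (1 - \<theta>) * ?I)"
    by (intro tendsto_intros R) auto
  also have "\<theta> * ?I + (1 - \<theta>) * ?I = ?I" by (simp add: algebra_simps)
  finally have lim: "(\<lambda>n. b / T ^ l * (\<theta> * ?R 0 n + (1 - \<theta>) * ?R 1 n)) \<longlonglongrightarrow> b / T ^ l * ?I" .
  have "?S n = b / T ^ l * (\<theta> * ?R 0 n + (1 - \<theta>) * ?R 1 n)" if "n > 0" for n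
  proof -
    obtain m where m: "l = Suc m" using \<open>l \<ge> 1\<close> by (cases l) auto
    have "b / T ^ l * (T / real n * ((real k * (T / real n)) ^ (l - 1) * x)) = b / real n ^ l * (real k ^ (l - 1) * x)" for k x
      using \<open>T > 0\<close> that by (simp add: m power_mult_distrib power_divide)
    note eq = this[symmetric]
    let ?a = "\<lambda>k. (real k * (T / real n)) ^ (l - 1)"
    have split: "C * (t * (a * (\<theta> * u + (1 - \<theta>) * x))) = \<theta> * (C * (t * (a * u))) + (1 - \<theta>) * (C * (t * (a * x)))"
      and collect: "\<theta> * (C * u) + (1 - \<theta>) * (C * x) = C * (\<theta> * u + (1 - \<theta>) * x)" for C t a u x
      by (simp_all add: algebra_simps)
    have "?S n = (\<Sum>k<n. \<theta> * (b / T ^ l * (T / real n * (?a k * F n k)))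
        + (1 - \<theta>) * (b / T ^ l * (T / real n * (?a k * F n (Suc k)))))"
      unfolding sum_distrib_left eq split ..
    also have "\<dots> = \<theta> * (b / T ^ l * ?R 0 n) + (1 - \<theta>) * (b / T ^ l * ?R 1 n)"
      by (simp only: sum.distrib sum_distrib_left[symmetric] Nat.add_0_right Suc_eq_plus1)
    also have "\<dots> = b / T ^ l * (\<theta> * ?R 0 n + (1 - \<theta>) * ?R 1 n)"
      by (rule collect)
    finally show ?thesis .
  qed
  then have "\<forall>\<^sub>F n in sequentially. b / T ^ l * (\<theta> * ?R 0 n + (1 - \<theta>) * ?R 1 n) = ?S n"
    by (intro eventually_mono[OF eventually_gt_at_top[of 0]]) simp
  with lim have "?S \<longlonglongrightarrow> b / T ^ l * ?I"
    by (rule Lim_transform_eventually)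
  from tendsto_add[OF diff this] show ?thesis by simp
qed

text \<open>
  It suffices that the scheme, tested against each left eigenvector of the system matrix, becomes a
  scalar one-step method with consistent coefficients.
\<close>

lemma legs_scheme_convergence:
  fixes s :: "real \<Rightarrow> (real \<Rightarrow> real) \<Rightarrow> nat \<Rightarrow> real ^ 'n::{finite,wellorder}"
  assumes "T > 0" and riem: "riemann_integrable_on f 0 T" and sol: "legs_solution T f c"
    and init: "\<And>h. s h f 0 = f 0 *\<^sub>R e1"
    and step: "\<And>w l. l \<ge> 1 \<Longrightarrow> w v* legs_A = real l *\<^sub>R w \<Longrightarrow> \<exists>\<theta> \<rho> p q. consistent_coeffs l \<theta> \<rho> p q \<and>
      (\<forall>h k. w \<bullet> s h f (Suc k) =
         \<rho> k * (w \<bullet> s h f k) + (w \<bullet> legs_B) * (p k * f (real k * h) + q k * f (real (Suc k) * h)))"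
  shows "(\<lambda>n. norm (s (T / real n) f n - c (real n * (T / real n)))) \<longlonglongrightarrow> 0"
proof -
  have "\<exists>w. w \<noteq> 0 \<and> w v* (legs_A :: ((real, 'n) vec, 'n) vec) = real (pos i) *\<^sub>R w" for i :: 'n
  proof -
    obtain w :: "(real, 'n) vec" where "w \<noteq> 0" "w v* legs_A = (legs_A $ i $ i) *\<^sub>R w"
      using lower_triangular_left_eigenvector[of legs_A i] legs_A_upper by blast
    then show "\<exists>w. w \<noteq> 0 \<and> w v* (legs_A :: ((real, 'n) vec, 'n) vec) = real (pos i) *\<^sub>R w"
      by (auto simp: legs_A_diag)
  qed
  then obtain g :: "'n \<Rightarrow> (real, 'n) vec" where nz: "\<And>i. g i \<noteq> 0"
    and eig: "\<And>i. g i v* legs_A = real (pos i) *\<^sub>R g i"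
    by metis
  have "inj (\<lambda>i :: 'n. real (pos i))"
    using bij_betw_pos[where 'n = 'n] by (auto simp: bij_betw_def inj_def)
  then have "span (range g) = UNIV"
    by (rule eigenvectors_span_UNIV[OF _ nz eig])
  then show ?thesis
  proof (rule tendsto_0_if_inner_spanning)
    fix w assume "w \<in> range g"
    then obtain i where w: "w = g i" by blast
    let ?l = "pos i"
    have e: "w v* legs_A = real ?l *\<^sub>R w" using eig w by simp
    obtain \<theta> \<rho> p q where coeffs: "consistent_coeffs ?l \<theta> \<rho> p q"
      and rec: "\<forall>h k. w \<bullet> s h f (Suc k) =
         \<rho> k * (w \<bullet> s h f k) + (w \<bullet> legs_B) * (p k * f (real k * h) + q k * f (real (Suc k) * h))"
      using step[OF pos_ge_1 e] by (elim exE conjE)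
    have "(\<lambda>n. w \<bullet> s (T / real n) f n) \<longlonglongrightarrow>
        (w \<bullet> legs_B) / T ^ ?l * integral {0..T} (\<lambda>s. s ^ (?l - 1) * f s)"
      by (rule scalar_one_step_scheme_tendsto[OF \<open>T > 0\<close> riem pos_ge_1 coeffs, where v = "w \<bullet> (f 0 *\<^sub>R e1)"])
         (simp_all only: init rec)
    also have "(w \<bullet> legs_B) / T ^ ?l * integral {0..T} (\<lambda>s. s ^ (?l - 1) * f s) = w \<bullet> c T"
      by (rule legs_solution_left_eigen[OF \<open>T > 0\<close> riem sol pos_ge_1 e, symmetric])
    finally have "(\<lambda>n. w \<bullet> s (T / real n) f n - w \<bullet> c T) \<longlonglongrightarrow> 0"
      by (simp add: LIM_zero)
    moreover have "\<forall>\<^sub>F n in sequentially. w \<bullet> s (T / real n) f n - w \<bullet> c T =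
        w \<bullet> (s (T / real n) f n - c (real n * (T / real n)))"
      by (intro eventually_mono[OF eventually_gt_at_top[of 0]]) (simp add: inner_diff_right)
    ultimately show "(\<lambda>n. w \<bullet> (s (T / real n) f n - c (real n * (T / real n)))) \<longlonglongrightarrow> 0"
      by (rule Lim_transform_eventually)
  qed
qed

theorem theorem2:
  fixes T :: real and f :: "real \<Rightarrow> real" and c :: "real \<Rightarrow> real ^ 'n::{finite,wellorder}"
  assumes "T > 0"
    and "riemann_integrable_on f 0 T"
    and "legs_solution T f c"
  shows "\<forall>scheme \<in> {forward_euler, backward_euler, bilinear_scheme, approx_bilinear_scheme, zero_order_hold}.
    (\<lambda>n. norm (scheme (T / real n) f n - c (real n * (T / real n)))) \<longlonglongrightarrow> 0"
proof -
  note converges = legs_scheme_convergence[OF assms]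
  have forward: "(\<lambda>n. norm (forward_euler (T / real n) f n - c (real n * (T / real n)))) \<longlonglongrightarrow> 0"
  proof (rule converges)
    fix w :: "(real, 'n) vec" and l :: nat assume eig: "w v* legs_A = real l *\<^sub>R w"
    \<comment> \<open>By the convention \<open>1 / 0 = 0\<close> the coefficients at \<open>k = 0\<close> are \<open>1\<close>, \<open>0\<close> and \<open>0\<close>, as in the
      special first step.\<close>
    let ?\<rho> = "\<lambda>k. 1 - real l / real k" and ?p = "\<lambda>k. 1 / real k" and ?q = "\<lambda>k. 0"
    have "consistent_coeffs l 1 ?\<rho> ?p ?q" by (simp add: consistent_coeffs_def)
    moreover have "w \<bullet> forward_euler h f (Suc k) = ?\<rho> k * (w \<bullet> forward_euler h f k)
        + (w \<bullet> legs_B) * (?p k * f (real k * h) + ?q k * f (real (Suc k) * h))" for h k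
      by (simp add: inner_add_right inner_explicit_step[OF eig])
    ultimately show "\<exists>\<theta> \<rho> p q. consistent_coeffs l \<theta> \<rho> p q \<and> (\<forall>h k. w \<bullet> forward_euler h f (Suc k) =
      \<rho> k * (w \<bullet> forward_euler h f k) + (w \<bullet> legs_B) * (p k * f (real k * h) + q k * f (real (Suc k) * h)))"
      by (intro exI conjI allI)
  qed simp
  have backward: "(\<lambda>n. norm (backward_euler (T / real n) f n - c (real n * (T / real n)))) \<longlonglongrightarrow> 0"
  proof (rule converges)
    fix w :: "(real, 'n) vec" and l :: nat assume "l \<ge> 1" and eig: "w v* legs_A = real l *\<^sub>R w"
    then have "real l \<ge> 1" by simp
    let ?d = "\<lambda>k. 1 + 1 / real (Suc k) * real l"
    let ?\<rho> = "\<lambda>k. 1 / ?d k" and ?p = "\<lambda>k. 0" and ?q = "\<lambda>k. 1 / real (Suc k) / ?d k"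
    have "consistent_coeffs l 0 ?\<rho> ?p ?q"
      unfolding consistent_coeffs_def by (intro conjI; use \<open>real l \<ge> 1\<close> in \<open>real_asymp | simp\<close>)
    moreover have "w \<bullet> backward_euler h f (Suc k) = ?\<rho> k * (w \<bullet> backward_euler h f k)
        + (w \<bullet> legs_B) * (?p k * f (real k * h) + ?q k * f (real (Suc k) * h))" for h k
      by (simp add: inner_add_right inner_implicit_solve[OF eig] add.commute[of 1 "real k"])
    ultimately show "\<exists>\<theta> \<rho> p q. consistent_coeffs l \<theta> \<rho> p q \<and> (\<forall>h k. w \<bullet> backward_euler h f (Suc k) =
      \<rho> k * (w \<bullet> backward_euler h f k) + (w \<bullet> legs_B) * (p k * f (real k * h) + q k * f (real (Suc k) * h)))"
      by (intro exI conjI allI)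
  qed simp
  have bilinear: "(\<lambda>n. norm (bilinear_scheme (T / real n) f n - c (real n * (T / real n)))) \<longlonglongrightarrow> 0"
  proof (rule converges)
    fix w :: "(real, 'n) vec" and l :: nat assume "l \<ge> 1" and eig: "w v* legs_A = real l *\<^sub>R w"
    then have "real l \<ge> 1" by simp
    let ?d = "\<lambda>k. 1 + 1 / (2 * real (Suc k)) * real l"
    \<comment> \<open>The special first step is again the case \<open>k = 0\<close> of the general formula with \<open>1 / 0 = 0\<close>.\<close>
    let ?\<rho> = "\<lambda>k. (1 - 1 / (2 * real k) * real l) / ?d k" and ?p = "\<lambda>k. 1 / (2 * real k) / ?d k"
      and ?q = "\<lambda>k. 1 / (2 * real (Suc k)) / ?d k"
    have "consistent_coeffs l (1 / 2) ?\<rho> ?p ?q"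
      unfolding consistent_coeffs_def by (intro conjI; use \<open>real l \<ge> 1\<close> in \<open>real_asymp | simp\<close>)
    moreover have "w \<bullet> bilinear_scheme h f (Suc k) = ?\<rho> k * (w \<bullet> bilinear_scheme h f k)
        + (w \<bullet> legs_B) * (?p k * f (real k * h) + ?q k * f (real (Suc k) * h))" for h k
    proof (cases "k = 0")
      case True
      have "w \<bullet> bilinear_scheme h f (Suc 0) =
          (w \<bullet> bilinear_scheme h f 0) / (1 + 1 / 2 * real l) + 1 / 2 * ((f h * (w \<bullet> legs_B)) / (1 + 1 / 2 * real l))"
        by (simp add: inner_add_right inner_implicit_solve[OF eig] del: bilinear_scheme.simps(1))
      then show ?thesis unfolding True by (simp add: mult_ac)
    next
      case False
      have "w \<bullet> bilinear_scheme h f (Suc k) =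
          (1 - 1 / (2 * real k) * real l) * (w \<bullet> bilinear_scheme h f k) / ?d k
          + (1 / (2 * real k) * f (real k * h) + 1 / (2 * real (Suc k)) * f (real (Suc k) * h)) * (w \<bullet> legs_B) / ?d k"
        using False by (simp add: inner_add_right inner_implicit_solve[OF eig] inner_explicit_step[OF eig] del: of_nat_Suc)
      then show ?thesis by (simp add: add_divide_distrib algebra_simps del: of_nat_Suc)
    qed
    ultimately show "\<exists>\<theta> \<rho> p q. consistent_coeffs l \<theta> \<rho> p q \<and> (\<forall>h k. w \<bullet> bilinear_scheme h f (Suc k) =
      \<rho> k * (w \<bullet> bilinear_scheme h f k) + (w \<bullet> legs_B) * (p k * f (real k * h) + q k * f (real (Suc k) * h)))"
      by (intro exI conjI allI)
  qed simp
  have approx: "(\<lambda>n. norm (approx_bilinear_scheme (T / real n) f n - c (real n * (T / real n)))) \<longlonglongrightarrow> 0"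
  proof (rule converges)
    fix w :: "(real, 'n) vec" and l :: nat assume "l \<ge> 1" and eig: "w v* legs_A = real l *\<^sub>R w"
    then have "real l \<ge> 1" by simp
    let ?d = "\<lambda>k. 1 + 1 / (2 * real (Suc k)) * real l"
    let ?\<rho> = "\<lambda>k. (1 - 1 / (2 * real (Suc k)) * real l) / ?d k" and ?p = "\<lambda>k. 0"
      and ?q = "\<lambda>k. 1 / real (Suc k) / ?d k"
    have "consistent_coeffs l 0 ?\<rho> ?p ?q"
      unfolding consistent_coeffs_def by (intro conjI; use \<open>real l \<ge> 1\<close> in \<open>real_asymp | simp\<close>)
    moreover have "w \<bullet> approx_bilinear_scheme h f (Suc k) = ?\<rho> k * (w \<bullet> approx_bilinear_scheme h f k)
        + (w \<bullet> legs_B) * (?p k * f (real k * h) + ?q k * f (real (Suc k) * h))" for h k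
      by (simp add: inner_add_right inner_implicit_solve[OF eig] inner_explicit_step[OF eig] del: of_nat_Suc)
    ultimately show "\<exists>\<theta> \<rho> p q. consistent_coeffs l \<theta> \<rho> p q \<and> (\<forall>h k. w \<bullet> approx_bilinear_scheme h f (Suc k) =
      \<rho> k * (w \<bullet> approx_bilinear_scheme h f k) + (w \<bullet> legs_B) * (p k * f (real k * h) + q k * f (real (Suc k) * h)))"
      by (intro exI conjI allI)
  qed simp
  have hold: "(\<lambda>n. norm (zero_order_hold (T / real n) f n - c (real n * (T / real n)))) \<longlonglongrightarrow> 0"
  proof (rule converges)
    fix w :: "(real, 'n) vec" and l :: nat assume "l \<ge> 1" and eig: "w v* legs_A = real l *\<^sub>R w"
    let ?\<rho> = "\<lambda>k. (real k / real (Suc k)) ^ l" and ?q = "\<lambda>k. 0"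
    let ?p = "\<lambda>k. (1 - ?\<rho> k) / real l"
    have "(\<lambda>k. (- 1 / real l) * (?\<rho> k - 1 + real l / real k)) \<in> O(\<lambda>k. 1 / (real k)\<^sup>2)"
      using power_ratio_expansion[of l] \<open>l \<ge> 1\<close> by (subst landau_o.big.cmult_in_iff) auto
    also have "(\<lambda>k. (- 1 / real l) * (?\<rho> k - 1 + real l / real k)) = (\<lambda>k. ?p k - 1 / real k)"
      using \<open>l \<ge> 1\<close> by (simp add: fun_eq_iff field_simps del: of_nat_Suc)
    finally have "consistent_coeffs l 1 ?\<rho> ?p ?q"
      using power_ratio_expansion[of l] by (simp add: consistent_coeffs_def del: of_nat_Suc)
    moreover have "w \<bullet> zero_order_hold h f (Suc k) = ?\<rho> k * (w \<bullet> zero_order_hold h f k)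
        + (w \<bullet> legs_B) * (?p k * f (real k * h) + ?q k * f (real (Suc k) * h))" for h k
    proof -
      have "w \<bullet> zero_order_hold h f (Suc k) = ?\<rho> k * (w \<bullet> zero_order_hold h f k)
          + (f (real k * h) * (w \<bullet> legs_B) - ?\<rho> k * (f (real k * h) * (w \<bullet> legs_B))) / real l"
        by (simp add: inner_add_right inner_legs_A_inverse[OF eig \<open>l \<ge> 1\<close>] inner_zoh_matrix[OF eig \<open>l \<ge> 1\<close>]
            matrix_vector_mult_diff_rdistrib inner_diff_right del: of_nat_Suc)
      then show ?thesis by (simp add: field_simps del: of_nat_Suc)
    qed
    ultimately show "\<exists>\<theta> \<rho> p q. consistent_coeffs l \<theta> \<rho> p q \<and> (\<forall>h k. w \<bullet> zero_order_hold h f (Suc k) =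
      \<rho> k * (w \<bullet> zero_order_hold h f k) + (w \<bullet> legs_B) * (p k * f (real k * h) + q k * f (real (Suc k) * h)))"
      by (intro exI conjI allI)
  qed simp
  from forward backward bilinear approx hold show ?thesis by simp
qed

end
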